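(* Let $s\in\mathbb{C}\setminus\{1\}$. Then: (i) for $\Re v>0$, $$\zeta(s,v)=\frac{v^{1-s}}{s-1}+\sum_{n=0}^\infty|G_{n+1}|\sum_{k=0}^{n}(-1)^k\binom{n}{k}(k+v)^{-s};$$ (ii) for $\Re v>1$, $$\zeta(s,v)=\frac{(v-1)^{1-s}}{s-1}-\sum_{n=0}^\infty C_{n+1}\sum_{k=0}^{n}(-1)^k\binom{n}{k}(k+v)^{-s};$$ (iii) for every positive integer $m$ and all $a,v$ with $\Re a\ge-1$ and $\Re v>-\Re a$, $$\zeta(s,v)=\frac{1}{m(s-1)}\sum_{n=0}^{m-1}(v+a+n)^{1-s}+\frac1m\sum_{n=0}^\infty(-1)^nN_{n+1,m}(a)\sum_{k=0}^{n}(-1)^k\binom{n}{k}(k+v)^{-s},$$ where the polynomials $N_{n,m}(a)=\int_a^{a+m}\binom{x}{n}\,dx$ satisfy $N_{n,m}(a)=\psi_{n+1}(a+m)-\psi_{n+1}(a)$ and have the generating function $\frac{(1+z)^{a+m}-(1+z)^a}{\ln(1+z)}=\sum_{n=0}^\infty N_{n,m}(a)z^n$ for $|z|<1$.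
   Context: $\zeta(s,v)=\sum_{n\ge0}(n+v)^{-s}$ is the Hurwitz zeta-function (analytically continued in $s$). Gregory's coefficients $G_n$ are defined by $\frac{z}{\ln(1+z)}=1+\sum_{n\ge1}G_nz^n$, $|z|<1$. The numbers $C_n$ are defined by $C_n=\frac{1}{n!}\int_0^1x(x+1)\cdots(x+n-1)\,dx$. For $n\in\mathbb{N}_0$, $\binom{x}{n}=\frac{x(x-1)\cdots(x-n+1)}{n!}$ (a polynomial in $x$), and $N_{n,m}(a)=\int_a^{a+m}\binom{x}{n}dx$. The Bernoulli polynomials of the second kind (Fontana–Bessel polynomials) $\psi_n(x)$ are defined by $\frac{z(1+z)^x}{\ln(1+z)}=\sum_{n\ge0}\psi_n(x)z^n$, $|z|<1$. Powers are principal branches. *)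

theory Defs
  imports "HOL-Complex_Analysis.Complex_Analysis"
begin

text \<open>
  The continuation in \<open>s\<close> of \<open>\<Sum>n. (n + v)\<^sup>-\<^sup>s\<close> (\<open>Re s > 1\<close>) to \<open>s \<noteq> 1\<close> is unique because \<open>- {1}\<close>
  is connected. Since \<open>0 powr z = 0\<close>, a term with \<open>n + v = 0\<close> is omitted from the series, which is
  the usual convention when \<open>v\<close> is a nonpositive integer.
\<close>
definition hurwitz_zeta :: "complex \<Rightarrow> complex \<Rightarrow> complex" where
  "hurwitz_zeta s v = (THE w. \<exists>f. f holomorphic_on (- {1}) \<and>
      (\<forall>z. Re z > 1 \<longrightarrow> (\<lambda>n. (of_nat n + v) powr (- z)) sums f z) \<and> w = f s)"

text \<open>
  The generating functions below are quotients by \<open>ln (1 + z)\<close> with a removable singularity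
  at \<open>z = 0\<close>, where HOL would evaluate \<open>0 / 0\<close> to \<open>0\<close>; hence \<^const>\<open>remove_sings\<close>.
\<close>
definition generating_function :: "(nat \<Rightarrow> complex) \<Rightarrow> (complex \<Rightarrow> complex) \<Rightarrow> bool" where
  "generating_function c f \<longleftrightarrow>
     (\<forall>z. norm z < 1 \<longrightarrow> (\<lambda>n. c n * z ^ n) sums remove_sings f z)"

text \<open>The constant term of \<open>z / ln (1 + z)\<close> is \<open>1\<close>, so index \<open>0\<close> carries the value \<open>1\<close>.\<close>
definition gregory_coeff :: "nat \<Rightarrow> real" where
  "gregory_coeff =
     (THE G. generating_function (\<lambda>n. of_real (G n)) (\<lambda>z. z / ln (1 + z)))"

definition cauchy_coeff :: "nat \<Rightarrow> real" where
  "cauchy_coeff n = 1 / fact n * integral {0..1} (\<lambda>x. pochhammer x n)"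

definition bernoulli2_poly :: "nat \<Rightarrow> complex \<Rightarrow> complex" where
  "bernoulli2_poly n x =
     (THE c. generating_function c (\<lambda>z. z * (1 + z) powr x / ln (1 + z))) n"

definition N_poly :: "nat \<Rightarrow> nat \<Rightarrow> complex \<Rightarrow> complex" where
  "N_poly n m a = contour_integral (linepath a (a + of_nat m)) (\<lambda>x. x gchoose n)"

end

theory Submission
  imports Defs
begin

text \<open>
  Parts (i) and (ii) are the cases \<open>m = 1\<close>, \<open>a = 0\<close> and \<open>m = 1\<close>, \<open>a = - 1\<close> of part (iii). Write
  \<open>S\<^sub>n(v,s)\<close> for the alternating difference \<open>\<Sum>k\<le>n. (-1)\<^sup>k (n choose k) (k + v)\<^sup>-\<^sup>s\<close>. For \<open>Re s > 1\<close> and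
  \<open>Re v > 0\<close>, the Gamma integral gives
  \<open>\<Gamma>(s) S\<^sub>n(v,s) = \<integral>\<^bsub>t > 0\<^esub> t\<^sup>s\<^sup>-\<^sup>1 e\<^sup>-\<^sup>v\<^sup>t (1 - e\<^sup>-\<^sup>t)\<^sup>n dt\<close>, so summing against \<open>(-1)\<^sup>n N\<^sub>n\<^sub>+\<^sub>1\<^sub>,\<^sub>m(a)\<close>
  under the integral evaluates the generating function of \<open>N\<^sub>n\<^sub>,\<^sub>m(a)\<close> at \<open>z = e\<^sup>-\<^sup>t - 1\<close>, and the result
  splits into Gamma integrals. If \<open>Re v \<le> 0\<close>, summation by parts replaces \<open>(v, a)\<close> by
  \<open>(v + 1, a - 1)\<close>. Finally \<open>S\<^sub>n(v,s) = O(n\<^sup>-\<^sup>y)\<close> for every \<open>y < Re v\<close>, locally uniformly in \<open>s\<close>,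
  while \<open>N\<^sub>n\<^sub>+\<^sub>1\<^sub>,\<^sub>m(a) = O(n\<^bsup>- Re a - 1\<^esup>)\<close>; so the series is holomorphic in \<open>s\<close> and provides the
  analytic continuation of the Hurwitz zeta function.
\<close>

section \<open>Generating functions\<close>

text \<open>The sum of a power series is continuous in the disc, so it is the limit of
  \<open>f\<close> at every point, in particular at 0, where the quotient \<open>f\<close> may carry
  a default value. Checking the expansion at nonzero \<open>z\<close> is therefore enough.\<close>

lemma generating_functionI:
  assumes "\<And>z. norm z < 1 \<Longrightarrow> z \<noteq> 0 \<Longrightarrow> (\<lambda>n. c n * z ^ n) sums f z"
  shows "generating_function c f"
proof -
  define g where "g = (\<lambda>z. \<Sum>n. c n * z ^ n)"
  have g: "(\<lambda>n. c n * z ^ n) sums g z" if "norm z < 1" for z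
  proof (cases "z = 0")
    case True
    then show ?thesis unfolding g_def using powser_sums_zero[of c] sums_summable summable_sums by blast
  next
    case False
    then show ?thesis unfolding g_def using assms that sums_summable summable_sums by blast
  qed
  have "g holomorphic_on ball 0 1"
    by (rule power_series_holomorphic[of 0 1 c]) (use g in auto)
  then have cont: "isCont g z" if "norm z < 1" for z
    using that holomorphic_on_imp_continuous_on continuous_on_eq_continuous_at[OF open_ball, of 0 1 g] by auto
  have "remove_sings f z = g z" if z: "norm z < 1" for z
  proof (rule remove_sings_eqI)
    have "eventually (\<lambda>w. norm w < 1) (at z)"
      using eventually_at_topological[of "\<lambda>w. norm w < 1" z] z by (metis mem_ball_0 open_ball)
    moreover have "eventually (\<lambda>w. w \<noteq> 0) (at z)"
      using eventually_neq_at_within[of 0 z UNIV] by simp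
    ultimately have "eventually (\<lambda>w. g w = f w) (at z)"
      by eventually_elim (use g assms sums_unique2 in blast)
    moreover have "g \<midarrow>z\<rightarrow> g z" using cont[OF z] by (simp add: isCont_def)
    ultimately show "f \<midarrow>z\<rightarrow> g z" using tendsto_cong by blast
  qed
  then show ?thesis unfolding generating_function_def using g by simp
qed

text \<open>Zeros of a nontrivial power series are isolated. This makes the definite descriptions in
  \<open>gregory_coeff\<close> and \<open>bernoulli2_poly\<close> well defined.\<close>

lemma generating_function_unique:
  assumes "generating_function c f" "generating_function d f"
  shows "c = d"
proof (rule ccontr)
  assume "c \<noteq> d"
  then obtain m where m: "c m \<noteq> d m" by auto
  define a where "a n = c n - d n" for n
  have a: "(\<lambda>n. a n * (z - 0) ^ n) sums 0" if "norm (z - 0) < 1" for z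
    using sums_diff[of "\<lambda>n. c n * z ^ n" "remove_sings f z" "\<lambda>n. d n * z ^ n" "remove_sings f z"] assms that
    by (simp add: a_def generating_function_def algebra_simps)
  have "a 0 = 0" using a[of 0] by simp
  then have "m > 0" using m by (cases m) (auto simp: a_def)
  \<comment> \<open>The difference series sums to the constant 0 but has a nonzero coefficient of
    positive index, so it would be nonzero on a punctured disc: hence the absurd
    \<open>0 \<noteq> 0\<close>.\<close>
  obtain s :: real where s: "s > 0" "\<And>z::complex. z \<in> cball 0 s - {0} \<Longrightarrow> (0::complex) \<noteq> 0"
    using powser_0_nonzero[of 1 0 a "\<lambda>_. 0" m] a m \<open>m > 0\<close> by (auto simp: a_def)
  from s(2)[of "of_real s"] s(1) show False by simp
qed

section \<open>Integrals of binomial polynomials and their generating functions\<close>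

lemma continuous_on_gbinomial [continuous_intros]:
  fixes f :: "'b::topological_space \<Rightarrow> 'a::real_normed_field"
  assumes "continuous_on A f"
  shows "continuous_on A (\<lambda>x. f x gchoose n)"
  unfolding gbinomial_prod_rev by (intro continuous_intros assms) auto

lemma complex_of_real_gbinomial: "complex_of_real (x gchoose n) = complex_of_real x gchoose n"
  by (simp add: gbinomial_prod_rev)

lemma N_poly_integral:
  "((\<lambda>t. ((a + of_real t * of_nat m) gchoose n) * of_nat m) has_integral N_poly n m a) {0..1}"
proof -
  have "(\<lambda>x. x gchoose n) contour_integrable_on linepath a (a + of_nat m)"
    by (intro contour_integrable_continuous_linepath continuous_intros)
  then have "((\<lambda>x. x gchoose n) has_contour_integral N_poly n m a) (linepath a (a + of_nat m))"
    unfolding N_poly_def by (rule has_contour_integral_integral)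
  moreover have "linepath a (a + of_nat m) t = a + of_real t * of_nat m" for t
    by (simp add: linepath_def algebra_simps scaleR_conv_of_real)
  ultimately show ?thesis by (simp add: has_contour_integral_linepath)
qed

lemma N_poly_0 [simp]: "N_poly 0 m a = of_nat m"
proof -
  have "((\<lambda>t::real. of_nat m) has_integral (of_nat m :: complex)) {0..1}"
    using has_integral_const_real[of "of_nat m::complex" 0 1] by simp
  moreover have "((\<lambda>t::real. of_nat m) has_integral N_poly 0 m a) {0..1}"
    using N_poly_integral[of a m 0] by simp
  ultimately show ?thesis by (rule has_integral_unique[rotated])
qed

text \<open>Pascal's rule under the integral. It later allows summation by parts to trade
  \<open>a\<close> for \<open>a - 1\<close>.\<close>

lemma N_poly_Suc: "N_poly (Suc n) m a = N_poly (Suc n) m (a - 1) + N_poly n m (a - 1)"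
proof -
  have "((a + of_real t * of_nat m) gchoose Suc n) * of_nat m =
     ((a - 1 + of_real t * of_nat m) gchoose Suc n) * of_nat m + ((a - 1 + of_real t * of_nat m) gchoose n) * of_nat m"
    for t
    using gbinomial_addition_formula[of "a + of_real t * of_nat m" n] by (simp add: algebra_simps)
  then have "((\<lambda>t. ((a + of_real t * of_nat m) gchoose Suc n) * of_nat m)
      has_integral N_poly (Suc n) m (a - 1) + N_poly n m (a - 1)) {0..1}"
    using has_integral_add[OF N_poly_integral[of "a-1" m "Suc n"] N_poly_integral[of "a-1" m n]] by simp
  then show ?thesis using N_poly_integral has_integral_unique by blast
qed

text \<open>Each factor \<open>x - i\<close> has modulus at most \<open>R + i\<close>, which is the
  modulus of the corresponding factor at \<open>- R\<close>. Thus one binomial series majorises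
  those of all \<open>x\<close> in a disc.\<close>

lemma norm_gbinomial_le:
  fixes x :: "'a::real_normed_field"
  assumes "norm x \<le> R"
  shows "norm (x gchoose n) \<le> \<bar>- R gchoose n\<bar>"
proof -
  have "norm (x - of_nat i) \<le> \<bar>- R - real i\<bar>" for i
    using norm_triangle_ineq4[of x "of_nat i"] assms by simp
  then have "(\<Prod>i = 0..<n. norm (x - of_nat i)) \<le> (\<Prod>i = 0..<n. \<bar>- R - real i\<bar>)"
    by (intro prod_mono) auto
  then show ?thesis
    unfolding gbinomial_prod_rev norm_divide abs_divide abs_prod prod_norm[symmetric]
    by (simp add: divide_right_mono)
qed

text \<open>Convergence at a point of modulus midway between \<open>norm z\<close> and 1 gives
  absolute convergence at \<open>z\<close>; that point is never the excluded value 0.\<close>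

lemma powser_summable_norm:
  fixes c :: "nat \<Rightarrow> complex"
  assumes "\<And>z. norm z < 1 \<Longrightarrow> z \<noteq> 0 \<Longrightarrow> summable (\<lambda>n. c n * z ^ n)" "norm z < 1"
  shows "summable (\<lambda>n. norm (c n * z ^ n))"
proof -
  define x where "x = complex_of_real ((1 + norm z) / 2)"
  have nx: "norm x = (1 + norm z) / 2" unfolding x_def norm_of_real by simp
  have "norm x < 1" "norm z < norm x" using assms(2) nx by auto
  moreover from this have "x \<noteq> 0" using norm_ge_zero[of z] by force
  ultimately show ?thesis using powser_insidea[of c x z] assms(1) by blast
qed

lemma one_plus_nonzero:
  fixes z :: complex
  assumes "norm z < 1"
  shows "1 + z \<noteq> 0"
proof
  assume "1 + z = 0"
  then have "z = - 1" by (simp add: add_eq_0_iff)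
  with assms show False by simp
qed

text \<open>The binomial series of \<open>(1 + z) powr x\<close> is integrated termwise in
  \<open>x\<close> along the segment from \<open>a\<close> to \<open>a + m\<close>, where it
  converges uniformly; \<open>(1 + z) powr x / ln (1 + z)\<close> is a primitive in
  \<open>x\<close>.\<close>

lemma N_poly_sums:
  assumes z: "norm z < 1" "z \<noteq> 0"
  shows "(\<lambda>n. N_poly n m a * z ^ n) sums
    (((1 + z) powr (a + of_nat m) - (1 + z) powr a) / ln (1 + z))"
proof -
  let ?g = "linepath a (a + of_nat m)"
  let ?F = "\<lambda>N x. \<Sum>n<N. (x gchoose n) * z ^ n"
  have nz: "1 + z \<noteq> 0" using z(1) by (rule one_plus_nonzero)
  have lnz: "ln (1 + z) \<noteq> 0" 
  proof
    assume "ln (1 + z) = 0"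
    then have "1 + z = 1" using exp_Ln[OF nz] by simp
    with z(2) show False by simp
  qed
  have int1: "(\<lambda>x. (x gchoose n) * z ^ n) contour_integrable_on ?g" for n
    by (intro contour_integrable_continuous_linepath continuous_intros)
  obtain R where R: "\<And>x. x \<in> path_image ?g \<Longrightarrow> norm x \<le> R"
    using compact_imp_bounded[OF compact_path_image[of ?g]] by (auto simp: bounded_iff)
  have sm: "summable (\<lambda>n. norm ((complex_of_real (- R) gchoose n) * z ^ n))"
    by (rule powser_summable_norm) (use z gen_binomial_complex sums_summable in blast)+
  have cr: "norm (complex_of_real (-R) gchoose n) = \<bar>- R gchoose n\<bar>" for n
    by (simp only: norm_of_real flip: complex_of_real_gbinomial)
  have "uniform_limit (path_image ?g) ?F (\<lambda>x. \<Sum>n. (x gchoose n) * z ^ n) sequentially"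
  proof (rule Weierstrass_m_test[OF _ sm])
    fix n x assume "x \<in> path_image ?g"
    then show "norm ((x gchoose n) * z ^ n) \<le> norm ((complex_of_real (- R) gchoose n) * z ^ n)"
      unfolding norm_mult cr by (intro mult_right_mono norm_gbinomial_le R norm_ge_zero)
  qed
  moreover have "(\<Sum>n. (x gchoose n) * z ^ n) = (1 + z) powr x" for x
    using sums_unique[OF gen_binomial_complex[OF z(1), of x]] by simp
  ultimately have ul: "uniform_limit (path_image ?g) ?F (\<lambda>x. (1 + z) powr x) sequentially" by simp
  have "((\<lambda>N. contour_integral ?g (?F N)) \<longlongrightarrow> contour_integral ?g (\<lambda>x. (1 + z) powr x)) sequentially"
    by (rule contour_integral_uniform_limit(2)[OF _ ul, where B = "norm (of_nat m :: complex)"])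
       (auto intro!: always_eventually contour_integrable_sum int1)
  moreover have "contour_integral ?g (?F N) = (\<Sum>n<N. N_poly n m a * z ^ n)" for N
  proof -
    have "contour_integral ?g (?F N) = (\<Sum>n<N. contour_integral ?g (\<lambda>x. (x gchoose n) * z ^ n))"
      by (intro contour_integral_sum int1) auto
    also have "\<dots> = (\<Sum>n<N. N_poly n m a * z ^ n)"
      unfolding N_poly_def
      by (intro sum.cong refl contour_integral_rmul contour_integrable_continuous_linepath continuous_intros)
    finally show ?thesis .
  qed
  ultimately have "(\<lambda>n. N_poly n m a * z ^ n) sums contour_integral ?g (\<lambda>x. (1 + z) powr x)"
    by (simp add: sums_def)
  moreover have "((\<lambda>x. (1 + z) powr x) has_contour_integral
      ((1 + z) powr (a + of_nat m) / ln (1 + z) - (1 + z) powr a / ln (1 + z))) ?g"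
  proof -
    have "((\<lambda>x. (1 + z) powr x / ln (1 + z)) has_field_derivative (1 + z) powr x) (at x within UNIV)" for x
      using nz lnz by (auto intro!: derivative_eq_intros simp: powr_def)
    from contour_integral_primitive[of UNIV, OF this valid_path_linepath] show ?thesis
      by (metis pathfinish_linepath pathstart_linepath top_greatest)
  qed
  ultimately show ?thesis using contour_integral_unique by (simp add: diff_divide_distrib)
qed

lemma generating_function_N_poly:
  "generating_function (\<lambda>n. N_poly n m a)
     (\<lambda>z. ((1 + z) powr (a + of_nat m) - (1 + z) powr a) / ln (1 + z))"
  by (intro generating_functionI N_poly_sums)

lemma inverse_log_sums:
  assumes z: "norm z < 1" "z \<noteq> 0"
  shows "(\<lambda>n. N_poly n 1 0 * z ^ n) sums (z / ln (1 + z))"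
  using N_poly_sums[OF z, of 1 0] one_plus_nonzero[OF z(1)] by simp

text \<open>The Cauchy product of the series of \<open>z / ln (1 + z)\<close> and of
  \<open>(1 + z) powr x\<close> provides a coefficient sequence; by uniqueness it is the one
  described in the definition.\<close>

lemma bernoulli2_poly_sums:
  assumes z: "norm z < 1" "z \<noteq> 0"
  shows "(\<lambda>n. bernoulli2_poly n x * z ^ n) sums (z * (1 + z) powr x / ln (1 + z))"
proof -
  define c where "c n = (\<Sum>i\<le>n. N_poly i 1 0 * (x gchoose (n - i)))" for n
  have c: "(\<lambda>n. c n * z ^ n) sums (z * (1 + z) powr x / ln (1 + z))" if z: "norm z < 1" "z \<noteq> 0" for z
  proof -
    have 1: "summable (\<lambda>n. norm (N_poly n 1 0 * z ^ n))" 
      by (rule powser_summable_norm) (use z inverse_log_sums sums_summable in blast)+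
    have 2: "summable (\<lambda>n. norm ((x gchoose n) * z ^ n))"
      by (rule powser_summable_norm) (use z gen_binomial_complex sums_summable in blast)+
    have "(\<Sum>i\<le>n. N_poly i 1 0 * z ^ i * ((x gchoose (n - i)) * z ^ (n - i))) = c n * z ^ n" for n
      unfolding c_def sum_distrib_right
      by (intro sum.cong refl) (simp add: mult_ac flip: power_add)
    with Cauchy_product_sums[OF 1 2] 
    show ?thesis
      unfolding sums_unique[OF inverse_log_sums[OF z], symmetric]
        sums_unique[OF gen_binomial_complex[OF z(1), of x], symmetric] by simp
  qed
  have "generating_function c (\<lambda>z. z * (1 + z) powr x / ln (1 + z))"
    by (intro generating_functionI c)
  then have "(THE c. generating_function c (\<lambda>z. z * (1 + z) powr x / ln (1 + z))) = c"
    using generating_function_unique by blast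
  then show ?thesis using c[OF z] by (simp add: bernoulli2_poly_def)
qed

lemma N_poly_eq_bernoulli2_poly_diff:
  "N_poly n m a = bernoulli2_poly (n + 1) (a + of_nat m) - bernoulli2_poly (n + 1) a"
proof -
  let ?f = "\<lambda>z::complex. z * (((1 + z) powr (a + of_nat m) - (1 + z) powr a) / ln (1 + z))"
  \<comment> \<open>The extra factor \<open>z\<close> in the generating function of
    \<open>bernoulli2_poly\<close> shifts the coefficients by one, which is the origin of the index
    \<open>n + 1\<close>.\<close>
  define d where "d k = (case k of 0 \<Rightarrow> 0 | Suc j \<Rightarrow> N_poly j m a)" for k
  have "generating_function d ?f"
  proof (rule generating_functionI)
    fix z :: complex assume z: "norm z < 1" "z \<noteq> 0"
    have "(\<lambda>n. d (Suc n) * z ^ Suc n) sums ?f z"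
      using sums_mult[OF N_poly_sums[OF z, of m a], of z] by (simp add: d_def mult_ac)
    then show "(\<lambda>n. d n * z ^ n) sums ?f z"
      by (subst (asm) sums_Suc_iff) (simp add: d_def)
  qed
  moreover have "generating_function (\<lambda>k. bernoulli2_poly k (a + of_nat m) - bernoulli2_poly k a) ?f"
  proof (rule generating_functionI)
    fix z :: complex assume z: "norm z < 1" "z \<noteq> 0"
    show "(\<lambda>k. (bernoulli2_poly k (a + of_nat m) - bernoulli2_poly k a) * z ^ k) sums ?f z"
      using sums_diff[OF bernoulli2_poly_sums[OF z, of "a + of_nat m"] bernoulli2_poly_sums[OF z, of a]]
      by (simp add: algebra_simps diff_divide_distrib)
  qed
  ultimately have "d = (\<lambda>k. bernoulli2_poly k (a + of_nat m) - bernoulli2_poly k a)"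
    by (rule generating_function_unique)
  from fun_cong[OF this, of "Suc n"] show ?thesis by (simp add: d_def)
qed

section \<open>Polynomiality in \<open>a\<close>, and the special values that give Gregory's and
  Cauchy's numbers\<close>

lemma poly_antiderivative_exists:
  fixes p :: "'a::field_char_0 poly"
  shows "\<exists>P. pderiv P = p"
proof -
  define P where "P = (\<Sum>i\<le>degree p. monom (coeff p i / of_nat (Suc i)) (Suc i))"
  have "pderiv P = (\<Sum>i\<le>degree p. monom (coeff p i) i)"
    unfolding P_def higher_pderiv_sum[where n = 1, simplified] by (intro sum.cong refl) (simp add: pderiv_monom del: of_nat_Suc)
  also have "\<dots> = p" by (rule poly_as_sum_of_monoms)
  finally show ?thesis by blast
qed

lemma N_poly_is_poly: "\<exists>p. \<forall>a. N_poly n m a = poly p a"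
proof -
  define q :: "complex poly" where "q = smult (1 / fact n) (\<Prod>i = 0..<n. [:- of_nat i, 1:])"
  have q: "poly q x = x gchoose n" for x
    by (simp add: q_def gbinomial_prod_rev poly_prod)
  obtain P where P: "pderiv P = q" using poly_antiderivative_exists by blast
  have "N_poly n m a = poly (pcompose P [:of_nat m, 1:] - P) a" for a
  proof -
    have "(poly P has_field_derivative (x gchoose n)) (at x within UNIV)" for x
      using poly_DERIV[of P x] by (simp add: P q)
    from contour_integral_primitive[of UNIV, OF this valid_path_linepath[of a "a + of_nat m"]]
    have "N_poly n m a = poly P (a + of_nat m) - poly P a"
      unfolding N_poly_def by (intro contour_integral_unique) simp
    then show ?thesis by (simp add: poly_pcompose add.commute)
  qed
  then show ?thesis by blast
qed

lemma N_poly_0_of_real: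
  "N_poly n 1 0 = of_real (integral {0..1} (\<lambda>t::real. t gchoose n))"
proof -
  have "((\<lambda>t::real. t gchoose n) has_integral integral {0..1} (\<lambda>t::real. t gchoose n)) {0..1}"
    by (intro integrable_integral integrable_continuous_real continuous_intros)
  from has_integral_of_real[OF this, where 'b = complex]
  have "((\<lambda>t. complex_of_real t gchoose n) has_integral of_real (integral {0..1} (\<lambda>t::real. t gchoose n))) {0..1}"
    by (simp add: complex_of_real_gbinomial)
  moreover have "((\<lambda>t. complex_of_real t gchoose n) has_integral N_poly n 1 0) {0..1}"
    using N_poly_integral[of 0 1 n] by simp
  ultimately show ?thesis by (rule has_integral_unique[rotated])
qed

text \<open>For \<open>m = 1\<close> and \<open>a = 0\<close> the numerator of the generating
  function is \<open>(1 + z) - 1 = z\<close>. The resulting coefficients are real, so uniqueness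
  identifies them with the sequence in the definition.\<close>

lemma gregory_coeff_eq: "gregory_coeff n = integral {0..1} (\<lambda>t::real. t gchoose n)"
proof -
  let ?G = "\<lambda>n. integral {0..1} (\<lambda>t::real. t gchoose n)"
  have "generating_function (\<lambda>n. N_poly n 1 0) (\<lambda>z. z / ln (1 + z))"
    by (intro generating_functionI inverse_log_sums)
  then have G: "generating_function (\<lambda>n. of_real (?G n)) (\<lambda>z. z / ln (1 + z))"
    by (simp only: N_poly_0_of_real)
  have "(THE G. generating_function (\<lambda>n. of_real (G n)) (\<lambda>z. z / ln (1 + z))) = ?G"
  proof (rule the_equality)
    show "generating_function (\<lambda>n. of_real (?G n)) (\<lambda>z. z / ln (1 + z))" by (rule G)
  next
    fix G assume "generating_function (\<lambda>n. of_real (G n)) (\<lambda>z. z / ln (1 + z))"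
    from generating_function_unique[OF this G] show "G = ?G" by (simp add: fun_eq_iff)
  qed
  then show ?thesis by (simp add: gregory_coeff_def)
qed

text \<open>On the unit interval the factors \<open>t - 1\<close>, ..., \<open>t - n\<close> of the
  binomial polynomial are all nonpositive, so the integrand has the constant sign
  \<open>(-1) ^ n\<close>.\<close>

lemma gregory_coeff_sign: "(-1) ^ n * gregory_coeff (Suc n) = \<bar>gregory_coeff (Suc n)\<bar>"
proof -
  have pos: "(-1) ^ n * (t gchoose Suc n) \<ge> 0" if "t \<in> {0..1}" for t :: real
  proof -
    have "(-1) ^ n * (t gchoose Suc n) = t * pochhammer (1 - t) n / fact (Suc n)"
      unfolding gbinomial_pochhammer pochhammer_rec
      by (simp add: algebra_simps flip: power_mult_distrib)
    also have "\<dots> \<ge> 0" using that unfolding pochhammer_prod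
      by (intro divide_nonneg_nonneg mult_nonneg_nonneg prod_nonneg) auto
    finally show ?thesis .
  qed
  have "(-1) ^ n * gregory_coeff (Suc n) = integral {0..1} (\<lambda>t::real. (-1) ^ n * (t gchoose Suc n))"
    by (simp add: gregory_coeff_eq)
  also have "\<dots> \<ge> 0" 
    by (rule integral_nonneg) (auto intro!: integrable_continuous_real continuous_intros pos)
  finally have "(-1) ^ n * gregory_coeff (Suc n) \<ge> 0" .
  then have "\<bar>(-1) ^ n * gregory_coeff (Suc n)\<bar> = (-1) ^ n * gregory_coeff (Suc n)" by simp
  then show ?thesis by (simp add: abs_mult)
qed

lemma N_poly_1_0: "(-1) ^ n * N_poly (n + 1) 1 0 = of_real \<bar>gregory_coeff (n + 1)\<bar>"
proof -
  have "(-1) ^ n * N_poly (n + 1) 1 0 = of_real ((-1) ^ n * gregory_coeff (Suc n))"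
    unfolding N_poly_0_of_real gregory_coeff_eq by simp
  then show ?thesis by (simp add: gregory_coeff_sign)
qed

text \<open>The substitution \<open>x = - t\<close> turns the binomial polynomial into a rising
  factorial up to the sign \<open>(-1) ^ (n + 1)\<close>. It parametrises the segment from 0 to -1,
  which is then reversed.\<close>

lemma N_poly_1_minus_1: "(-1) ^ n * N_poly (n + 1) 1 (-1) = - of_real (cauchy_coeff (n + 1))"
proof -
  let ?I = "integral {0..1} (\<lambda>x::real. pochhammer x (n + 1))"
  have "continuous_on {0..1} (\<lambda>x::real. pochhammer x (n+1))"
    unfolding pochhammer_prod by (intro continuous_intros)
  then have "((\<lambda>x::real. pochhammer x (n + 1)) has_integral ?I) {0..1}"
    by (intro integrable_integral integrable_continuous_real)
  then have "((\<lambda>x. complex_of_real (pochhammer x (n + 1))) has_integral of_real ?I) {0..1}"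
    by (rule has_integral_of_real)
  from has_integral_mult_left[OF this, of "- ((-1) ^ (n + 1) / fact (n + 1))"]
  have "((\<lambda>x. x gchoose (n + 1)) has_contour_integral
      (of_real ?I * (- ((-1) ^ (n + 1) / fact (n + 1))))) (linepath 0 (-1))"
    unfolding has_contour_integral_linepath gbinomial_pochhammer
    by (simp add: linepath_def scaleR_conv_of_real pochhammer_of_real mult_ac)
  from has_contour_integral_reversepath[OF valid_path_linepath this]
  have "((\<lambda>x. x gchoose (n + 1)) has_contour_integral
      - (of_real ?I * (- ((-1) ^ (n + 1) / fact (n + 1))))) (linepath (-1) 0)"
    by simp
  then have "N_poly (n + 1) 1 (-1) = of_real ?I * ((-1) ^ (n + 1) / fact (n + 1))"
    unfolding N_poly_def by (intro contour_integral_unique) simp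
  then show ?thesis by (simp add: cauchy_coeff_def)
qed

section \<open>The Gamma integral\<close>

text \<open>Integrand of the Gamma integral for \<open>Gamma s * x powr (- s)\<close>. The extension
  by 0 lets every integral run over the whole real line with \<open>lborel\<close>.\<close>

definition gamma_kernel :: "complex \<Rightarrow> complex \<Rightarrow> real \<Rightarrow> complex" where
  "gamma_kernel s x t = (if t > 0 then of_real t powr (s - 1) * exp (- x * of_real t) else 0)"

lemma gamma_kernel_measurable [measurable]: "gamma_kernel s x \<in> borel_measurable borel"
proof -
  have "set_borel_measurable borel {0<..} (\<lambda>t. complex_of_real t powr (s - 1) * exp (- x * of_real t))"
    unfolding set_borel_measurable_def
    by (intro borel_measurable_continuous_on_indicator continuous_intros) (auto simp: complex_nonpos_Reals_iff)
  moreover have "(\<lambda>t. indicator {0<..} t *\<^sub>R (complex_of_real t powr (s - 1) * exp (- x * of_real t))) = gamma_kernel s x"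
    by (auto simp: gamma_kernel_def fun_eq_iff indicator_def)
  ultimately show ?thesis unfolding set_borel_measurable_def by metis
qed

lemma norm_gamma_kernel: "norm (gamma_kernel s x t) = norm (gamma_kernel (of_real (Re s)) (of_real (Re x)) t)"
  by (simp add: gamma_kernel_def norm_mult norm_powr_real_powr)

lemma gamma_kernel_of_real:
  "gamma_kernel (of_real \<sigma>) (of_real x) t = of_real (norm (gamma_kernel (of_real \<sigma>) (of_real x) t))"
proof (cases "t > 0")
  case True
  have "complex_of_real t powr (of_real \<sigma> - 1) = of_real (t powr (\<sigma> - 1))"
    using True powr_of_real[of t "\<sigma> - 1"] by simp
  moreover have "exp (- complex_of_real x * of_real t) = of_real (exp (- x * t))"
    by (simp flip: exp_of_real)
  ultimately show ?thesis using True by (simp add: gamma_kernel_def norm_mult flip: of_real_mult)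
qed (simp add: gamma_kernel_def)

lemma gamma_kernel_add: "gamma_kernel s (x + y) t = gamma_kernel s x t * exp (- y * of_real t)"
  by (simp add: gamma_kernel_def algebra_simps flip: exp_add)

lemma gamma_kernel_power: "gamma_kernel (s + of_nat n) x t = gamma_kernel s x t * of_real t ^ n"
proof (cases "t > 0")
  case True
  then have "complex_of_real t powr (s + of_nat n - 1) = of_real t powr (s - 1) * of_real t ^ n"
    by (metis add_diff_eq diff_add_eq of_real_eq_0_iff order_less_irrefl powr_add powr_nat')
  then show ?thesis using True by (simp add: gamma_kernel_def)
qed (simp add: gamma_kernel_def)

lemma gamma_kernel_integral_1:
  assumes "Re s > 0"
  shows "has_bochner_integral lborel (gamma_kernel s 1) (Gamma s)"
proof -
  let ?f = "\<lambda>t. complex_of_real t powr (s - 1) / of_real (exp t)"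
  have eq: "(\<lambda>t. indicator {0<..} t *\<^sub>R ?f t) = gamma_kernel s 1"
    by (auto simp: gamma_kernel_def fun_eq_iff indicator_def exp_minus field_simps exp_of_real)
  have ai: "?f absolutely_integrable_on {0<..}"
    by (rule absolutely_integrable_Gamma_integral'[OF assms])
  have "integrable lebesgue (gamma_kernel s 1)"
    using ai unfolding set_integrable_def eq .
  then have int: "integrable lborel (gamma_kernel s 1)"
    by (subst (asm) integrable_completion) auto
  have "integral\<^sup>L lebesgue (gamma_kernel s 1) = Gamma s"
    using set_lebesgue_integral_eq_integral(2)[OF ai] integral_unique[OF Gamma_integral_complex'[OF assms]]
    unfolding set_lebesgue_integral_def eq by simp
  then have "integral\<^sup>L lborel (gamma_kernel s 1) = Gamma s"
    by (subst (asm) integral_completion) auto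
  with int show ?thesis by (simp add: has_bochner_integral_iff)
qed

text \<open>The substitution of \<open>x * t\<close> for \<open>t\<close> reduces this to
  \<open>x = 1\<close>; the factor \<open>x powr (1 - s)\<close> then undoes the power produced by
  scaling.\<close>

lemma gamma_kernel_integral_real:
  assumes "Re s > 0" "x > 0"
  shows "has_bochner_integral lborel (gamma_kernel s (of_real x)) (Gamma s * of_real x powr (- s))"
proof -
  have scale: "gamma_kernel s 1 (0 + x * t) = of_real x powr (s - 1) * gamma_kernel s (of_real x) t" for t
    using assms(2) by (auto simp: gamma_kernel_def powr_times_real zero_less_mult_iff)
  have "has_bochner_integral lborel (\<lambda>t. gamma_kernel s 1 (0 + x * t)) (Gamma s /\<^sub>R \<bar>x\<bar>)"
    using gamma_kernel_integral_1[OF assms(1)] lborel_has_bochner_integral_real_affine_iff[of x] assms(2) by blast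
  then have "has_bochner_integral lborel (\<lambda>t. of_real x powr (s - 1) * gamma_kernel s (of_real x) t) (Gamma s /\<^sub>R x)"
    using assms(2) unfolding scale by simp
  from has_bochner_integral_mult_right[OF this, of "of_real x powr (1 - s)"]
  have "has_bochner_integral lborel (\<lambda>t. (of_real x powr (1 - s) * of_real x powr (s - 1)) * gamma_kernel s (of_real x) t)
     (of_real x powr (1 - s) * (Gamma s /\<^sub>R x))"
    by (simp add: mult_ac)
  moreover have "complex_of_real x powr (1 - s) * of_real x powr (s - 1) = 1"
    using assms(2) by (simp flip: powr_add)
  moreover have "complex_of_real x powr (1 - s) * (Gamma s /\<^sub>R x) = Gamma s * of_real x powr (- s)"
    using assms(2) powr_add[of "complex_of_real x" 1 "- s"] by (simp add: scaleR_conv_of_real field_simps)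
  ultimately show ?thesis by simp
qed

text \<open>The modulus of the kernel depends only on the real parts of the parameters, and for real
  parameters the kernel is its own modulus. So this is again a real Gamma integral.\<close>

lemma gamma_kernel_integral_norm:
  assumes "Re s > 0" "Re x > 0"
  shows "has_bochner_integral lborel (\<lambda>t. norm (gamma_kernel s x t)) (Gamma (Re s) * Re x powr (- Re s))"
proof -
  have "complex_of_real (Re x) powr (- complex_of_real (Re s)) = of_real (Re x powr (- Re s))"
    using assms(2) powr_of_real[of "Re x" "- Re s"] by simp
  with gamma_kernel_integral_real[of "of_real (Re s)" "Re x"] assms
  have "has_bochner_integral lborel (\<lambda>t. complex_of_real (norm (gamma_kernel s x t)))
      (of_real (Gamma (Re s) * Re x powr (- Re s)))"
    by (subst norm_gamma_kernel, subst gamma_kernel_of_real[symmetric]) (simp add: Gamma_complex_of_real)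
  from has_bochner_integral_bounded_linear[OF bounded_linear_Re this] show ?thesis by simp
qed

lemma Gamma_mult_gbinomial:
  fixes s :: "'a::Gamma"
  assumes "s \<notin> \<int>\<^sub>\<le>\<^sub>0"
  shows "Gamma (s + of_nat n) / fact n = Gamma s * ((-1) ^ n * (- s gchoose n))"
  using pochhammer_Gamma[OF assms, of n] Gamma_eq_zero_iff[of s] assms
  by (simp add: gbinomial_pochhammer field_simps flip: power_mult_distrib)

text \<open>Expanding the exponential around a large real point reduces complex \<open>x\<close> to the binomial series.\<close>
lemma gamma_kernel_integral:
  assumes s: "Re s > 0" and x: "Re x > 0"
  shows "has_bochner_integral lborel (gamma_kernel s x) (Gamma s * x powr (- s))"
proof -
  \<comment> \<open>Chosen so that \<open>2 * y * Re x = (norm x)^2 + 1\<close>, hence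
    \<open>(norm (x - y))^2 = y^2 - 1\<close>: the disc of radius \<open>y\<close> about
    \<open>y\<close> contains \<open>x\<close>.\<close>
  define y where "y = ((norm x)\<^sup>2 + 1) / (2 * Re x)"
  define w where "w = x - of_real y"
  have y: "y > 0" unfolding y_def using x by (intro divide_pos_pos) (auto intro: add_nonneg_pos)
  have "(norm w)\<^sup>2 = (norm x)\<^sup>2 - 2 * y * Re x + y\<^sup>2"
    by (simp add: w_def cmod_power2) (simp add: power2_eq_square algebra_simps)
  also have "2 * y * Re x = (norm x)\<^sup>2 + 1" using x by (simp add: y_def)
  finally have "(norm w)\<^sup>2 < y\<^sup>2" by simp
  then have wy: "norm w < y" using y by (simp add: power2_less_imp_less)
  \<comment> \<open>Terms of the expansion of \<open>exp (- w * t)\<close> times the kernel at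
    \<open>y\<close>; the power \<open>t ^ n\<close> is absorbed by shifting \<open>s\<close> to
    \<open>s + n\<close>.\<close>
  define f where "f n t = (- w) ^ n / fact n * gamma_kernel (s + of_nat n) (of_real y) t" for n t
  have pn: "z \<notin> \<int>\<^sub>\<le>\<^sub>0" if "Re z > 0" for z :: complex
    using that by (auto elim!: nonpos_Ints_cases)
  have term_eq: "(- W) ^ n / fact n * (Gamma (z + of_nat n) * of_real y powr (- (z + of_nat n))) =
      Gamma z * of_real y powr (- z) * ((- z gchoose n) * (W / of_real y) ^ n)" if "Re z > 0" for n W and z :: complex
  proof -
    have 1: "Gamma (z + of_nat n) = fact n * (Gamma z * ((-1) ^ n * (- z gchoose n)))"
      using Gamma_mult_gbinomial[OF pn[OF that], of n] by (simp add: field_simps)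
    have 2: "complex_of_real y powr (- (z + of_nat n)) = of_real y powr (- z) / of_real y ^ n"
      using y by (simp add: powr_diff powr_nat')
    have 3: "W ^ n = (- W) ^ n * (- 1) ^ n" by (simp flip: power_mult_distrib)
    show ?thesis unfolding 1 2 power_divide 3 by simp
  qed
  have int: "has_bochner_integral lborel (f n) (Gamma s * of_real y powr (- s) * ((- s gchoose n) * (w / of_real y) ^ n))" for n
    unfolding f_def term_eq[OF s, symmetric]
    by (intro has_bochner_integral_mult_right gamma_kernel_integral_real) (use s y in auto)
  have nw: "norm (w / of_real y) < 1" using wy y by (simp add: norm_divide)
  \<comment> \<open>The integrals of the moduli are the moduli of the terms of the same binomial
    series for the real exponent \<open>- Re s\<close> at the point \<open>- r / y\<close>, which
    still lies in the unit disc. This justifies exchanging sum and integral.\<close>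
  define r where "r = complex_of_real (norm w)"
  have nr: "norm (- r / of_real y) < 1" using wy y by (simp add: norm_divide r_def)
  have norm_int: "(LINT t|lborel. norm (f n t)) = norm (Gamma (complex_of_real (Re s)) * of_real y powr (- of_real (Re s)) *
      ((- of_real (Re s) gchoose n) * (- r / of_real y) ^ n))" for n
  proof -
    have "norm (f n t) = norm w ^ n / fact n * norm (gamma_kernel (s + of_nat n) (of_real y) t)" for t
      by (simp add: f_def norm_mult norm_divide norm_power)
    then have "(LINT t|lborel. norm (f n t)) = norm w ^ n / fact n * (Gamma (Re s + n) * y powr (- (Re s + n)))"
      using gamma_kernel_integral_norm[of "s + of_nat n" "of_real y"] s y
      by (simp add: has_bochner_integral_iff)
    also have "\<dots> = norm (r ^ n / fact n * (Gamma (of_real (Re s) + of_nat n) * of_real y powr (- (of_real (Re s) + of_nat n))))"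
    proof -
      have "Gamma (complex_of_real (Re s) + of_nat n) = of_real (Gamma (Re s + n))"
        using Gamma_complex_of_real[of "Re s + n"] by simp
      moreover have "complex_of_real y powr (- (of_real (Re s) + of_nat n)) = of_real (y powr (- (Re s + n)))"
        using powr_of_real[of y "- (Re s + n)"] y by simp
      moreover have "Gamma (Re s + n) > 0" using s by (intro Gamma_real_pos) auto
      ultimately show ?thesis by (simp add: norm_mult norm_divide norm_power r_def)
    qed
    also have "\<dots> = norm (Gamma (complex_of_real (Re s)) * of_real y powr (- of_real (Re s)) *
      ((- of_real (Re s) gchoose n) * (- r / of_real y) ^ n))"
      using term_eq[of "of_real (Re s)" "- r" n] s by simp
    finally show ?thesis .
  qed
  have fsums: "(\<lambda>n. f n t) sums gamma_kernel s x t" for t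
  proof -
    have "(\<lambda>n. gamma_kernel s (of_real y) t * ((- w * of_real t) ^ n /\<^sub>R fact n)) sums
        (gamma_kernel s (of_real y) t * exp (- w * of_real t))"
      by (intro sums_mult exp_converges)
    moreover have "gamma_kernel s (of_real y) t * ((- w * of_real t) ^ n /\<^sub>R fact n) = f n t" for n
      unfolding f_def gamma_kernel_power power_mult_distrib by (simp add: scaleR_conv_of_real field_simps)
    moreover have "gamma_kernel s (of_real y) t * exp (- w * of_real t) = gamma_kernel s x t"
      unfolding gamma_kernel_add[symmetric] by (simp add: w_def)
    ultimately show ?thesis by simp
  qed
  have fabs: "summable (\<lambda>n. norm (f n t))" for t
  proof -
    have "summable (\<lambda>n. norm (gamma_kernel s (of_real y) t) * norm ((- w * of_real t) ^ n /\<^sub>R fact n))"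
      by (intro summable_mult summable_norm_exp)
    then show ?thesis
      by (simp add: f_def gamma_kernel_power norm_mult norm_divide norm_power power_mult_distrib field_simps)
  qed
  have sint: "summable (\<lambda>n. LINT t|lborel. norm (f n t))"
    unfolding norm_int norm_mult[of "Gamma _ * _"]
    by (intro summable_mult powser_summable_norm nr) (use gen_binomial_complex sums_summable in blast)
  have fe: "(\<lambda>t. \<Sum>n. f n t) = gamma_kernel s x"
    using sums_unique[OF fsums] by (simp add: fun_eq_iff)
  have I: "integrable lborel (gamma_kernel s x)"
    unfolding fe[symmetric]
    by (rule integrable_suminf) (use int fabs sint in \<open>auto simp: has_bochner_integral_iff\<close>)
  have "(\<lambda>n. integral\<^sup>L lborel (f n)) sums (LINT t|lborel. (\<Sum>n. f n t))"
    by (rule sums_integral) (use int fabs sint in \<open>auto simp: has_bochner_integral_iff\<close>)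
  then have "(\<lambda>n. Gamma s * of_real y powr (- s) * ((- s gchoose n) * (w / of_real y) ^ n)) sums
      integral\<^sup>L lborel (gamma_kernel s x)"
    using int unfolding fe by (simp add: has_bochner_integral_iff)
  moreover have "(\<lambda>n. Gamma s * of_real y powr (- s) * ((- s gchoose n) * (w / of_real y) ^ n)) sums
      (Gamma s * of_real y powr (- s) * (1 + w / of_real y) powr (- s))"
    by (intro sums_mult gen_binomial_complex nw)
  ultimately have "integral\<^sup>L lborel (gamma_kernel s x) = Gamma s * (of_real y powr (- s) * (1 + w / of_real y) powr (- s))"
    using sums_unique2 by (metis mult.assoc)
  also have "of_real y powr (- s) * (1 + w / of_real y) powr (- s) = (of_real y * (1 + w / of_real y)) powr (- s)"
    using y by (subst powr_times_real_left) auto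
  also have "of_real y * (1 + w / of_real y) = x" using y by (simp add: w_def field_simps)
  finally show ?thesis using I by (simp add: has_bochner_integral_iff)
qed

section \<open>Decay of the alternating differences and of the coefficients\<close>

definition power_diff :: "nat \<Rightarrow> complex \<Rightarrow> complex \<Rightarrow> complex" where
  "power_diff n v s = (\<Sum>k=0..n. (-1) ^ k * of_nat (n choose k) * (of_nat k + v) powr (- s))"

lemma power_diff_0 [simp]: "power_diff 0 v s = v powr (- s)"
  by (simp add: power_diff_def)

lemma power_diff_Suc: "power_diff (Suc n) v s = power_diff n v s - power_diff n (v + 1) s"
proof -
  define F where "F k = (of_nat k + v) powr (- s)" for k
  have "power_diff (Suc n) v s = F 0 + (\<Sum>k\<le>n. (-1) ^ Suc k * of_nat (Suc n choose Suc k) * F (Suc k))"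
    unfolding power_diff_def atLeast0AtMost F_def[symmetric] by (subst sum.atMost_Suc_shift) simp
  also have "(\<Sum>k\<le>n. (-1) ^ Suc k * of_nat (Suc n choose Suc k) * F (Suc k)) =
      (\<Sum>k\<le>n. (-1) ^ Suc k * of_nat (n choose Suc k) * F (Suc k)) - (\<Sum>k\<le>n. (-1) ^ k * of_nat (n choose k) * F (Suc k))"
    unfolding sum_subtractf[symmetric] by (intro sum.cong refl) (simp add: algebra_simps)
  also have "(\<Sum>k\<le>n. (-1) ^ k * of_nat (n choose k) * F (Suc k)) = power_diff n (v + 1) s"
    by (simp add: power_diff_def atLeast0AtMost F_def algebra_simps)
  also have "F 0 + ((\<Sum>k\<le>n. (-1) ^ Suc k * of_nat (n choose Suc k) * F (Suc k)) - power_diff n (v + 1) s) =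
      (\<Sum>k\<le>Suc n. (-1) ^ k * of_nat (n choose k) * F k) - power_diff n (v + 1) s"
    by (subst sum.atMost_Suc_shift) simp
  also have "(\<Sum>k\<le>Suc n. (-1) ^ k * of_nat (n choose k) * F k) = power_diff n v s"
    by (simp add: power_diff_def atLeast0AtMost F_def)
  finally show ?thesis .
qed

lemma power_diff_eq_sum: "power_diff n v s = v powr (- s) - (\<Sum>k<n. power_diff k (v + 1) s)"
  by (induction n) (simp_all add: power_diff_Suc)

text \<open>Splits off one factor \<open>k + v\<close> from each power and absorbs \<open>k\<close>
  by \<open>k * (n choose k) = n * (n - 1 choose k - 1)\<close>. This carries bounds at
  \<open>s + 1\<close> over to \<open>s\<close>. For \<open>n = 0\<close> the truncated
  \<open>n - 1\<close> is harmless because of the factor \<open>n\<close>.\<close>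

lemma power_diff_lower:
  "power_diff n v s = v * power_diff n v (s + 1) - of_nat n * power_diff (n - 1) (v + 1) (s + 1)"
proof (cases n)
  case 0
  then show ?thesis using powr_add[of v 1 "- (s + 1)"] by (cases "v = 0") simp_all
next
  case (Suc m)
  define G where "G k = (of_nat k + v) powr (- (s + 1))" for k
  \<comment> \<open>If \<open>k + v = 0\<close>, both sides vanish, since \<open>0 powr\<close>
    anything is 0.\<close>
  have F: "(of_nat k + v) powr (- s) = v * G k + of_nat k * G k" for k
  proof (cases "of_nat k + v = 0")
    case False
    then show ?thesis using powr_add[of "of_nat k + v" 1 "- (s + 1)"] by (simp add: G_def algebra_simps)
  qed (simp add: G_def)
  have "power_diff n v s = v * (\<Sum>k\<le>n. (-1) ^ k * of_nat (n choose k) * G k)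
      + (\<Sum>k\<le>n. (-1) ^ k * of_nat (n choose k) * (of_nat k * G k))"
    unfolding power_diff_def F atLeast0AtMost sum_distrib_left sum.distrib[symmetric]
    by (intro sum.cong refl) (simp add: algebra_simps)
  also have "(\<Sum>k\<le>n. (-1) ^ k * of_nat (n choose k) * (of_nat k * G k)) =
      (\<Sum>k\<le>m. - (of_nat n * ((-1) ^ k * of_nat (m choose k) * G (Suc k))))"
  proof -
    have "of_nat (Suc k) * of_nat (Suc m choose Suc k) = (of_nat (Suc m) * of_nat (m choose k) :: complex)" for k
      by (metis Suc_times_binomial_eq mult.commute of_nat_mult)
    then have "(-1) ^ Suc k * of_nat (Suc m choose Suc k) * (of_nat (Suc k) * G (Suc k)) =
       - (of_nat n * ((-1) ^ k * of_nat (m choose k) * G (Suc k)))" for k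
      unfolding Suc by (simp add: algebra_simps del: of_nat_Suc binomial_Suc_Suc)
    note * = this
    show ?thesis
      unfolding Suc sum.atMost_Suc_shift using * unfolding Suc by (simp del: of_nat_Suc binomial_Suc_Suc power_Suc)
  qed
  also have "\<dots> = - (of_nat n * power_diff m (v + 1) (s + 1))"
    unfolding sum_negf sum_distrib_left[symmetric]
    by (simp add: power_diff_def G_def atLeast0AtMost algebra_simps)
  finally show ?thesis by (simp add: Suc power_diff_def G_def atLeast0AtMost)
qed

text \<open>Expanding the power of \<open>1 - exp (- t)\<close> by the binomial theorem, each
  \<open>exp (- k * t)\<close> shifts the kernel parameter from \<open>v\<close> to
  \<open>k + v\<close>.\<close>

lemma power_diff_integral:
  assumes "Re s > 0" "Re v > 0"
  shows "has_bochner_integral lborel (\<lambda>t. gamma_kernel s v t * (1 - exp (- of_real t)) ^ n)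
    (Gamma s * power_diff n v s)"
proof -
  have "gamma_kernel s v t * (1 - exp (- of_real t)) ^ n =
      (\<Sum>k=0..n. (-1) ^ k * of_nat (n choose k) * gamma_kernel s (of_nat k + v) t)" for t
  proof -
    have "(1 - exp (- complex_of_real t)) ^ n = (\<Sum>k=0..n. of_nat (n choose k) * (- exp (- of_real t)) ^ k)"
      using binomial_ring[of "- exp (- complex_of_real t)" 1 n] by (simp add: atLeast0AtMost)
    also have "gamma_kernel s v t * \<dots> = (\<Sum>k=0..n. (-1) ^ k * of_nat (n choose k) * gamma_kernel s (of_nat k + v) t)"
      unfolding sum_distrib_left
    proof (intro sum.cong refl)
      fix k
      have "gamma_kernel s (of_nat k + v) t = gamma_kernel s v t * exp (- of_real t) ^ k"
        using gamma_kernel_add[of s v "of_nat k" t] by (simp add: add.commute flip: exp_of_nat_mult)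
      then show "gamma_kernel s v t * (of_nat (n choose k) * (- exp (- of_real t)) ^ k) =
         (-1) ^ k * of_nat (n choose k) * gamma_kernel s (of_nat k + v) t"
        by (simp add: power_minus[of "exp _"])
    qed
    finally show ?thesis .
  qed
  moreover have "has_bochner_integral lborel (\<lambda>t. \<Sum>k=0..n. (-1) ^ k * of_nat (n choose k) * gamma_kernel s (of_nat k + v) t)
     (\<Sum>k=0..n. (-1) ^ k * of_nat (n choose k) * (Gamma s * (of_nat k + v) powr (- s)))"
    by (intro has_bochner_integral_sum has_bochner_integral_mult_right gamma_kernel_integral) (use assms in auto)
  ultimately show ?thesis by (simp add: power_diff_def sum_distrib_left mult_ac)
qed

text \<open>With \<open>w = (n + 1) * u\<close>, the first factor is at most
  \<open>exp (1 - w)\<close>, while \<open>w / y \<le> exp (w / y)\<close> bounds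
  \<open>w powr y\<close> by \<open>y powr y * exp w\<close>; the exponentials in \<open>w\<close>
  cancel.\<close>

lemma one_minus_power_times_powr_le:
  fixes u y :: real
  assumes u: "0 < u" "u \<le> 1" and y: "y > 0"
  shows "(1 - u) ^ n * u powr y \<le> exp 1 * y powr y * (real n + 1) powr (- y)"
proof -
  define w where "w = (real n + 1) * u"
  have w: "w > 0" using u by (simp add: w_def)
  have "(1 - u) ^ n \<le> exp (- u) ^ n"
    using u exp_ge_add_one_self[of "- u"] by (intro power_mono) auto
  also have "\<dots> = exp (- (real n * u))" by (simp flip: exp_of_nat_mult)
  also have "\<dots> \<le> exp (1 - w)" using u by (simp add: w_def algebra_simps)
  finally have 1: "(1 - u) ^ n \<le> exp (1 - w)" .
  have "w powr y = y powr y * (w / y) powr y" using w y by (simp flip: powr_mult)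
  also have "\<dots> \<le> y powr y * exp (w / y) powr y"
    using w y less_imp_le[OF exp_gt_self[of "w / y"]] by (intro mult_left_mono powr_mono2) auto
  also have "\<dots> = y powr y * exp w" using y by (simp add: exp_powr_real)
  finally have 2: "w powr y \<le> y powr y * exp w" .
  have "u = w * inverse (real n + 1)" by (simp add: w_def)
  then have "u powr y = w powr y * (real n + 1) powr (- y)"
    using w by (simp add: powr_mult powr_minus inverse_powr)
  then have "(1 - u) ^ n * u powr y = ((1 - u) ^ n * w powr y) * (real n + 1) powr (- y)" by simp
  also have "\<dots> \<le> (exp (1 - w) * (y powr y * exp w)) * (real n + 1) powr (- y)"
    using 1 2 u by (intro mult_right_mono mult_mono) auto
  also have "exp (1 - w) * (y powr y * exp w) = exp 1 * y powr y" by (simp add: exp_diff)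
  finally show ?thesis .
qed

text \<open>A factor \<open>exp (- y * t)\<close> is split off the kernel and paired with
  \<open>(1 - exp (- t)) ^ n\<close>, which gives the decay in \<open>n\<close>; the remaining
  kernel at \<open>v - y\<close> is still integrable.\<close>

lemma power_diff_integral_norm_le:
  assumes s: "Re s > 0" and y: "0 < y" "y < Re v"
  shows "(LINT t|lborel. norm (gamma_kernel s v t * (1 - exp (- of_real t)) ^ n)) \<le>
    exp 1 * y powr y * (Gamma (Re s) * (Re v - y) powr (- Re s)) * (real n + 1) powr (- y)"
proof -
  define E where "E = exp 1 * y powr y * (real n + 1) powr (- y)"
  have le: "norm (gamma_kernel s v t * (1 - exp (- of_real t)) ^ n) \<le> E * norm (gamma_kernel s (v - of_real y) t)" for t
  proof (cases "t > 0")
    case True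
    have "norm (gamma_kernel s v t) = norm (gamma_kernel s (v - of_real y) t) * exp (- t) powr y"
      using gamma_kernel_add[of s "v - of_real y" "of_real y" t] by (simp add: norm_mult exp_powr_real mult.commute)
    moreover have "norm (1 - exp (- complex_of_real t)) = 1 - exp (- t)"
    proof -
      have "1 - exp (- complex_of_real t) = of_real (1 - exp (- t))" by (simp flip: exp_of_real)
      then show ?thesis using True by (simp only: norm_of_real) simp
    qed
    ultimately have "norm (gamma_kernel s v t * (1 - exp (- of_real t)) ^ n) =
        ((1 - exp (- t)) ^ n * exp (- t) powr y) * norm (gamma_kernel s (v - of_real y) t)"
      by (simp add: norm_mult norm_power mult_ac)
    also have "\<dots> \<le> E * norm (gamma_kernel s (v - of_real y) t)"
      unfolding E_def using True y(1) by (intro mult_right_mono one_minus_power_times_powr_le) auto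
    finally show ?thesis .
  qed (simp add: gamma_kernel_def)
  have I: "has_bochner_integral lborel (\<lambda>t. E * norm (gamma_kernel s (v - of_real y) t))
      (E * (Gamma (Re s) * (Re v - y) powr (- Re s)))"
    using gamma_kernel_integral_norm[of s "v - of_real y"] s y by (intro has_bochner_integral_mult_right) auto
  have "(LINT t|lborel. norm (gamma_kernel s v t * (1 - exp (- of_real t)) ^ n)) \<le>
      (LINT t|lborel. E * norm (gamma_kernel s (v - of_real y) t))"
    using power_diff_integral[of s v n] I s y
    by (intro integral_mono le integrable_norm) (auto simp: has_bochner_integral_iff)
  also have "\<dots> = E * (Gamma (Re s) * (Re v - y) powr (- Re s))"
    using I by (simp add: has_bochner_integral_iff)
  finally show ?thesis by (simp add: E_def mult_ac)
qed

text \<open>Dividing the integral bound by \<open>norm (Gamma s)\<close>, which does not vanish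
  here, leaves a constant that is continuous in \<open>s\<close> and so bounded on
  \<open>K\<close>.\<close>

lemma power_diff_bound_pos:
  assumes "compact K" "\<And>s. s \<in> K \<Longrightarrow> Re s > 0" "0 < y" "y < Re v"
  shows "\<exists>C\<ge>0. \<forall>s\<in>K. \<forall>n. norm (power_diff n v s) \<le> C * (real n + 1) powr (- y)"
proof -
  define B where "B s = exp 1 * y powr y * (Gamma (Re s) * (Re v - y) powr (- Re s)) / norm (Gamma s)" for s
  have pn: "z \<notin> \<int>\<^sub>\<le>\<^sub>0" if "Re z > 0" for z :: complex
    using that by (auto elim!: nonpos_Ints_cases)
  have pnr: "x \<notin> \<int>\<^sub>\<le>\<^sub>0" if "x > 0" for x :: real
    using that by (auto elim!: nonpos_Ints_cases)
  have "continuous_on K (\<lambda>s. Gamma (Re s))"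
    by (rule continuous_on_compose2[of "{0<..}" Gamma]) (use assms(2) pnr in \<open>auto intro!: continuous_intros\<close>)
  then have "continuous_on K B"
    unfolding B_def
    by (intro continuous_intros) (use assms pn pnr in \<open>auto simp: Gamma_eq_zero_iff\<close>)
  then have "bounded (B ` K)" using assms(1) compact_continuous_image compact_imp_bounded by blast
  then obtain C where C: "C > 0" "\<And>s. s \<in> K \<Longrightarrow> \<bar>B s\<bar> \<le> C" by (auto simp: bounded_pos)
  have "norm (power_diff n v s) \<le> C * (real n + 1) powr (- y)" if "s \<in> K" for s n
  proof -
    have s: "Re s > 0" using assms(2) that .
    have G: "norm (Gamma s) > 0" using pn[OF s] by (simp add: Gamma_eq_zero_iff)
    have "norm (Gamma s) * norm (power_diff n v s) = norm (LINT t|lborel. gamma_kernel s v t * (1 - exp (- of_real t)) ^ n)"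
      using power_diff_integral[of s v n] s assms(3,4) by (simp add: has_bochner_integral_iff norm_mult)
    also have "\<dots> \<le> (LINT t|lborel. norm (gamma_kernel s v t * (1 - exp (- of_real t)) ^ n))"
      by (rule integral_norm_bound)
    also have "\<dots> \<le> exp 1 * y powr y * (Gamma (Re s) * (Re v - y) powr (- Re s)) * (real n + 1) powr (- y)"
      by (rule power_diff_integral_norm_le[OF s assms(3,4)])
    also have "\<dots> = norm (Gamma s) * (B s * (real n + 1) powr (- y))"
      using G by (simp add: B_def)
    finally have "norm (power_diff n v s) \<le> B s * (real n + 1) powr (- y)"
      using G by simp
    also have "\<dots> \<le> C * (real n + 1) powr (- y)"
      using C(2)[OF that] by (intro mult_right_mono) auto
    finally show ?thesis .
  qed
  then show ?thesis using C(1) by (intro exI[of _ C]) auto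
qed

text \<open>Induction to the left in \<open>s\<close> through \<open>power_diff_lower\<close>. The
  factor \<open>n\<close> there costs one power of \<open>n\<close>, which is regained because the
  difference is taken at \<open>v + 1\<close>, where the exponent \<open>y + 1\<close> is
  available.\<close>

lemma power_diff_bound_right_half_plane:
  assumes "compact K" "\<And>s. s \<in> K \<Longrightarrow> Re s > - real N" "0 < y" "y < Re v"
  shows "\<exists>C\<ge>0. \<forall>s\<in>K. \<forall>n. norm (power_diff n v s) \<le> C * (real n + 1) powr (- y)"
  using assms
proof (induction N arbitrary: K v y)
  case 0
  then show ?case by (intro power_diff_bound_pos) auto
next
  case (Suc N)
  let ?K = "(\<lambda>s. s + 1) ` K"
  have K: "compact ?K" using Suc.prems(1) by (intro compact_continuous_image continuous_intros)
  have ReK: "Re s > - real N" if "s \<in> ?K" for s using Suc.prems(2) that by force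
  obtain C where C: "C \<ge> 0" "\<And>s n. s \<in> K \<Longrightarrow> norm (power_diff n v (s + 1)) \<le> C * (real n + 1) powr (- y)"
    using Suc.IH[of ?K y v, OF K ReK] Suc.prems(3,4) by auto
  obtain D where D: "D \<ge> 0" "\<And>s n. s \<in> K \<Longrightarrow> norm (power_diff n (v + 1) (s + 1)) \<le> D * (real n + 1) powr (- (y + 1))"
    using Suc.IH[of ?K "y + 1" "v + 1", OF K ReK] Suc.prems(3,4) by auto
  have "norm (power_diff n v s) \<le> (norm v * C + D * 2 powr y) * (real n + 1) powr (- y)" if s: "s \<in> K" for s n
  proof -
    have "real n * norm (power_diff (n - 1) (v + 1) (s + 1)) \<le> D * 2 powr y * (real n + 1) powr (- y)"
    proof (cases n)
      case 0
      then show ?thesis using D(1) by simp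
    next
      case (Suc k)
      have "real n * norm (power_diff (n - 1) (v + 1) (s + 1)) \<le> real n * (D * real n powr (- (y + 1)))"
        using D(2)[OF s, of k] Suc by (intro mult_left_mono) (auto simp: add.commute)
      also have "\<dots> = D * real n powr (- y)"
        using Suc powr_add[of "real n" 1 "- (y + 1)"] by simp
      \<comment> \<open>For \<open>n \<ge> 1\<close> one has \<open>(n + 1) / 2 \<le> n\<close>;
        this is the source of the constant \<open>2 powr y\<close>.\<close>
      also have "\<dots> \<le> D * ((real n + 1) / 2) powr (- y)"
        using Suc \<open>0 < y\<close> D(1) by (intro mult_left_mono powr_mono2') auto
      also have "((real n + 1) / 2) powr (- y) = (real n + 1) powr (- y) / 2 powr (- y)"
        by (rule powr_divide)
      also have "\<dots> = 2 powr y * (real n + 1) powr (- y)"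
        using powr_minus_divide[of 2 y] by simp
      finally show ?thesis by (simp add: mult.assoc)
    qed
    moreover have "norm v * norm (power_diff n v (s + 1)) \<le> norm v * (C * (real n + 1) powr (- y))"
      using C(2)[OF s] by (intro mult_left_mono) auto
    moreover have "norm (power_diff n v s) \<le> norm v * norm (power_diff n v (s + 1)) + real n * norm (power_diff (n - 1) (v + 1) (s + 1))"
      using norm_triangle_ineq4[of "v * power_diff n v (s + 1)" "of_nat n * power_diff (n - 1) (v + 1) (s + 1)"]
      unfolding power_diff_lower[of n v s, symmetric] by (simp add: norm_mult)
    ultimately show ?thesis by (simp add: algebra_simps)
  qed
  then show ?case using C(1) D(1) by (intro exI[of _ "norm v * C + D * 2 powr y"]) auto
qed

lemma summable_Suc_powr:
  fixes p :: real
  assumes "p > 1"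
  shows "summable (\<lambda>n. (real n + 1) powr (- p))"
proof -
  have "summable (\<lambda>n. real (Suc n) powr (- p))"
    using assms by (subst summable_Suc_iff) (simp add: summable_real_powr_iff)
  then show ?thesis by (simp add: add.commute)
qed

text \<open>Induction to the left in \<open>Re v\<close>: \<open>power_diff_eq_sum\<close> writes
  the difference at \<open>v\<close> as \<open>v powr (- s)\<close> minus a partial sum of
  differences at \<open>v + 1\<close>, whose bounds are summed.\<close>

lemma power_diff_bound_aux:
  assumes K: "compact K" and "Re v > - real N" "y < Re v"
  shows "\<exists>C\<ge>0. \<forall>s\<in>K. \<forall>n. norm (power_diff n v s) \<le> C * (real n + 1) powr (- y)"
  using assms(2,3)
proof (induction N arbitrary: v y)
  case 0
  \<comment> \<open>The earlier bound requires a positive exponent; raising \<open>y\<close> only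
    strengthens the estimate.\<close>
  define y' where "y' = max y (Re v / 2)"
  have y': "0 < y'" "y' < Re v" using 0 by (auto simp: y'_def)
  obtain B where B: "\<And>s. s \<in> K \<Longrightarrow> norm s \<le> B"
    using compact_imp_bounded[OF K] by (auto simp: bounded_iff)
  obtain M :: nat where M: "real M > B" using reals_Archimedean2 by blast
  have "Re s > - real M" if "s \<in> K" for s
    using B[OF that] M abs_Re_le_cmod[of s] by linarith
  then obtain C where C: "C \<ge> 0" "\<And>s n. s \<in> K \<Longrightarrow> norm (power_diff n v s) \<le> C * (real n + 1) powr (- y')"
    using power_diff_bound_right_half_plane[OF K, of M y' v] y' by auto
  have "C * (real n + 1) powr (- y') \<le> C * (real n + 1) powr (- y)" for n
    using C(1) by (intro mult_left_mono powr_mono) (auto simp: y'_def)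
  then show ?case using C by (meson order_trans)
next
  case (Suc N)
  show ?case
  proof (cases "Re v > - real N")
    case True
    then show ?thesis using Suc by blast
  next
    case False
    then have v: "Re v \<le> 0" by linarith
    \<comment> \<open>The gap \<open>y' - y\<close> is spent on summability:
      \<open>(k + 1) powr (- (y' + 1))\<close> leaves a convergent factor of exponent
      \<open>1 + (y' - y)\<close> after \<open>(k + 1) powr (- y)\<close> is split off.\<close>
    define y' where "y' = (y + Re v) / 2"
    have y': "y < y'" "y' < Re v" using Suc.prems by (auto simp: y'_def)
    obtain C where C: "C \<ge> 0" "\<And>s n. s \<in> K \<Longrightarrow> norm (power_diff n (v + 1) s) \<le> C * (real n + 1) powr (- (y' + 1))"
      using Suc.IH[of "v + 1" "y' + 1"] Suc.prems y' by auto
    have "continuous_on K (\<lambda>s. v powr (- s))"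
      by (cases "v = 0") (auto intro!: continuous_intros simp: powr_def)
    then have "bounded ((\<lambda>s. v powr (- s)) ` K)" using K compact_continuous_image compact_imp_bounded by blast
    then obtain D where D: "D > 0" "\<And>s. s \<in> K \<Longrightarrow> norm (v powr (- s)) \<le> D" by (auto simp: bounded_pos)
    define Z where "Z = (\<Sum>k. (real k + 1) powr (- (1 + (y' - y))))"
    have sm: "summable (\<lambda>k. (real k + 1) powr (- (1 + (y' - y))))"
      using y' by (intro summable_Suc_powr) auto
    have Z: "Z \<ge> 0" unfolding Z_def by (intro suminf_nonneg sm) auto
    have "norm (power_diff n v s) \<le> (D + C * Z) * (real n + 1) powr (- y)" if s: "s \<in> K" for s n
    proof -
      have "norm (\<Sum>k<n. power_diff k (v + 1) s) \<le> (\<Sum>k<n. C * (real n + 1) powr (- y) * (real k + 1) powr (- (1 + (y' - y))))"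
      proof (rule sum_norm_le)
        fix k assume k: "k \<in> {..<n}"
        have "(real k + 1) powr (- (y' + 1)) = (real k + 1) powr (- y) * (real k + 1) powr (- (1 + (y' - y)))"
          by (simp flip: powr_add)
        \<comment> \<open>Here \<open>y < Re v \<le> 0\<close>, so the power with exponent
          \<open>- y\<close> increases with its base.\<close>
        also have "\<dots> \<le> (real n + 1) powr (- y) * (real k + 1) powr (- (1 + (y' - y)))"
          using k v y' by (intro mult_right_mono powr_mono2) auto
        finally show "norm (power_diff k (v + 1) s) \<le> C * (real n + 1) powr (- y) * (real k + 1) powr (- (1 + (y' - y)))"
          using C(2)[OF s, of k] C(1) by (smt (verit) mult.assoc mult_left_mono)
      qed
      also have "\<dots> \<le> C * (real n + 1) powr (- y) * Z"
        unfolding sum_distrib_left[symmetric] Z_def using C(1) by (intro mult_left_mono sum_le_suminf sm) auto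
      finally have 1: "norm (\<Sum>k<n. power_diff k (v + 1) s) \<le> C * (real n + 1) powr (- y) * Z" .
      have "1 \<le> (real n + 1) powr (- y)" using v y' by (intro ge_one_powr_ge_zero) auto
      then have "D \<le> D * (real n + 1) powr (- y)" using D(1) by simp
      then have 2: "norm (v powr (- s)) \<le> D * (real n + 1) powr (- y)" using D(2)[OF s] by linarith
      show ?thesis
        unfolding power_diff_eq_sum[of n v s]
        using norm_triangle_ineq4[of "v powr (- s)" "\<Sum>k<n. power_diff k (v + 1) s"] 1 2
        by (simp add: algebra_simps)
    qed
    then show ?thesis using C(1) D(1) Z by (intro exI[of _ "D + C * Z"]) auto
  qed
qed

lemma power_diff_bound:
  assumes "compact K" "y < Re v"
  shows "\<exists>C\<ge>0. \<forall>s\<in>K. \<forall>n. norm (power_diff n v s) \<le> C * (real n + 1) powr (- y)"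
proof -
  obtain N :: nat where "real N > - Re v" using reals_Archimedean2 by blast
  then have "Re v > - real N" by linarith
  from power_diff_bound_aux[OF assms(1) this assms(2)] show ?thesis .
qed

text \<open>Consecutive binomials differ by the factor \<open>- (1 - w)\<close> with
  \<open>w = (x + 1) / (n + 1)\<close>, and
  \<open>norm (1 - w) \<le> exp (- Re w + (norm w)^2 / 2)\<close>. Multiplying up, the real parts
  collect into a harmonic number and the squares into a bounded sum.\<close>

lemma norm_gbinomial_decay:
  fixes x :: complex
  shows "norm (x gchoose n) \<le> exp (- (Re x + 1) * harm n + (norm (x + 1))\<^sup>2 / 2 * (\<Sum>k<n. 1 / real ((k + 1)\<^sup>2)))"
proof (induction n)
  case (Suc n)
  define w where "w = (x + 1) / of_nat (Suc n)"
  have *: "norm (1 - w) \<le> exp (- Re w + (norm w)\<^sup>2 / 2)"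
  proof (rule power2_le_imp_le)
    have "(norm (1 - w))\<^sup>2 = 1 + (- 2 * Re w + (norm w)\<^sup>2)"
      by (simp add: cmod_power2) (simp add: power2_eq_square algebra_simps)
    also have "\<dots> \<le> exp (- 2 * Re w + (norm w)\<^sup>2)" by (rule exp_ge_add_one_self)
    also have "\<dots> = (exp (- Re w + (norm w)\<^sup>2 / 2))\<^sup>2"
      by (simp add: algebra_simps flip: exp_double)
    finally show "(norm (1 - w))\<^sup>2 \<le> (exp (- Re w + (norm w)\<^sup>2 / 2))\<^sup>2" .
  qed simp
  have Rew: "Re w = (Re x + 1) * inverse (real (Suc n))"
    unfolding w_def Re_divide_of_nat by (simp add: divide_inverse)
  have nw: "(norm w)\<^sup>2 = (norm (x + 1))\<^sup>2 * (1 / real ((n + 1)\<^sup>2))"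
    unfolding w_def norm_divide power_divide norm_of_nat by (simp del: of_nat_Suc)
  have "x gchoose Suc n = - (x gchoose n) * (1 - w)"
  proof -
    have "(x gchoose Suc n) * of_nat (Suc n) = (x gchoose n) * (x - of_nat n)"
      unfolding gbinomial_prod_rev by (simp add: field_simps del: of_nat_Suc)
    moreover have "w * of_nat (Suc n) = x + 1"
      by (simp add: w_def del: of_nat_Suc)
    then have "(1 - w) * of_nat (Suc n) = - (x - of_nat n)"
      by (simp add: algebra_simps)
    ultimately have "(x gchoose Suc n) * of_nat (Suc n) = (- (x gchoose n) * (1 - w)) * of_nat (Suc n)"
      by (metis minus_mult_minus mult.assoc)
    then show ?thesis by (metis mult_right_cancel of_nat_neq_0)
  qed
  then have "norm (x gchoose Suc n) = norm (x gchoose n) * norm (1 - w)" by (simp add: norm_mult)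
  also have "\<dots> \<le> exp (- (Re x + 1) * harm n + (norm (x + 1))\<^sup>2 / 2 * (\<Sum>k<n. 1 / real ((k + 1)\<^sup>2))) *
     exp (- Re w + (norm w)\<^sup>2 / 2)"
    by (intro mult_mono Suc.IH *) auto
  also have "\<dots> = exp (- (Re x + 1) * harm (Suc n) + (norm (x + 1))\<^sup>2 / 2 * (\<Sum>k<Suc n. 1 / real ((k + 1)\<^sup>2)))"
  proof -
    have "- A * h + B / 2 * S + (- (A * i) + B * q / 2) = - A * (h + i) + B / 2 * (S + q)" for A B h i q S :: real
      by (simp add: algebra_simps)
    then show ?thesis unfolding Rew nw harm_Suc sum.lessThan_Suc exp_add[symmetric] by (intro arg_cong[where f = exp])
  qed
  finally show ?case .
qed (simp add: harm_def)

text \<open>Harmonic numbers dominate the logarithm, which turns the exponential bound into a power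
  of \<open>n + 1\<close>. On the segment \<open>Re x + 1 \<ge> Re a + 1 \<ge> 0\<close>, so the
  estimate is uniform in \<open>x\<close>, and the inverse squares contribute at most
  \<open>pi^2 / 6\<close>.\<close>

lemma N_poly_bound:
  assumes a: "Re a \<ge> - 1"
  shows "\<exists>C\<ge>0. \<forall>n. norm (N_poly (n + 1) m a) \<le> C * (real n + 1) powr (- (Re a + 1))"
proof -
  obtain R where R: "\<And>x. x \<in> closed_segment a (a + of_nat m) \<Longrightarrow> norm (x + 1) \<le> R"
  proof -
    have "bounded ((\<lambda>x. x + 1) ` closed_segment a (a + of_nat m))"
      by (intro compact_imp_bounded compact_continuous_image continuous_intros) auto
    then show ?thesis using that by (auto simp: bounded_iff)
  qed
  define D where "D = exp (R\<^sup>2 / 2 * (pi\<^sup>2 / 6))"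
  have "norm (N_poly (n + 1) m a) \<le> (D * real m) * (real n + 1) powr (- (Re a + 1))" for n
  proof -
    have "norm (x gchoose (n + 1)) \<le> D * (real n + 1) powr (- (Re a + 1))"
      if x: "x \<in> closed_segment a (a + of_nat m)" for x
    proof -
      have "Re x \<ge> Re a" using x by (auto simp: closed_segment_def algebra_simps)
      then have "(Re a + 1) * ln (real n + 1) \<le> (Re x + 1) * harm (n + 1)"
      proof (intro mult_mono)
        have "ln (real n + 1) \<le> ln (real (n + 1) + 1)" by simp
        also have "\<dots> \<le> harm (n + 1)" by (rule ln_le_harm)
        finally show "ln (real n + 1) \<le> harm (n + 1)" .
      qed (use a in auto)
      moreover have "(norm (x + 1))\<^sup>2 / 2 * (\<Sum>k<n+1. 1 / real ((k + 1)\<^sup>2)) \<le> R\<^sup>2 / 2 * (pi\<^sup>2 / 6)"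
      proof (intro mult_mono)
        show "(\<Sum>k<n+1. 1 / real ((k + 1)\<^sup>2)) \<le> pi\<^sup>2 / 6"
          using sum_le_suminf[OF sums_summable[OF inverse_squares_sums], of "{..<n+1}"]
            sums_unique[OF inverse_squares_sums] by simp
        show "(norm (x + 1))\<^sup>2 / 2 \<le> R\<^sup>2 / 2" using R[OF x] by (intro divide_right_mono power_mono) auto
        show "0 \<le> (\<Sum>k<n+1. 1 / real ((k + 1)\<^sup>2))" by (intro sum_nonneg) auto
      qed auto
      moreover have "exp (- p + q) \<le> exp (r + - l)" if "l \<le> p" "q \<le> r" for p q r l :: real
        using that by simp
      ultimately have "norm (x gchoose (n + 1)) \<le> exp (R\<^sup>2 / 2 * (pi\<^sup>2 / 6) + - ((Re a + 1) * ln (real n + 1)))"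
        using norm_gbinomial_decay[of x "n + 1"] unfolding mult_minus_left by (meson order_trans)
      also have "\<dots> = D * (real n + 1) powr (- (Re a + 1))"
        unfolding exp_add D_def powr_def mult_minus_left by simp
      finally show ?thesis .
    qed
    then have "norm (N_poly (n + 1) m a) \<le> D * (real n + 1) powr (- (Re a + 1)) * norm (a + of_nat m - a)"
      unfolding N_poly_def
      by (intro contour_integral_bound_linepath contour_integrable_continuous_linepath continuous_intros)
         (auto simp: D_def)
    then show ?thesis by (simp add: mult_ac)
  qed
  then show ?thesis by (intro exI[of _ "D * real m"]) (simp add: D_def)
qed

section \<open>The Hurwitz zeta function\<close>

text \<open>The geometric series in \<open>exp (- t)\<close> expands
  \<open>1 / (1 - exp (- t))\<close>, and each term shifts \<open>v\<close> by one in the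
  kernel.\<close>

lemma hurwitz_series_integral:
  assumes s: "Re s > 1" and v: "Re v > 0"
  defines "Z \<equiv> \<lambda>t. gamma_kernel s v t / (1 - exp (- of_real t))"
  shows "integrable lborel Z"
    and "(\<lambda>k. Gamma s * (of_nat k + v) powr (- s)) sums integral\<^sup>L lborel Z"
proof -
  define f where "f k t = gamma_kernel s (of_nat k + v) t" for k t
  have int: "has_bochner_integral lborel (f k) (Gamma s * (of_nat k + v) powr (- s))" for k
    unfolding f_def by (intro gamma_kernel_integral) (use s v in auto)
  have feq: "f k t = gamma_kernel s v t * exp (- of_real t) ^ k" for k t
    using gamma_kernel_add[of s v "of_nat k" t] by (simp add: f_def add.commute flip: exp_of_nat_mult)
  have fsums: "(\<lambda>k. f k t) sums Z t" and fabs: "summable (\<lambda>k. norm (f k t))" for t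
  proof -
    show "(\<lambda>k. f k t) sums Z t"
    proof (cases "t > 0")
      case True
      then have "(\<lambda>k. exp (- complex_of_real t) ^ k) sums (1 / (1 - exp (- of_real t)))"
        by (intro geometric_sums) simp
      from sums_mult[OF this, of "gamma_kernel s v t"] show ?thesis by (simp add: feq Z_def)
    qed (simp add: f_def gamma_kernel_def Z_def)
    show "summable (\<lambda>k. norm (f k t))"
    proof (cases "t > 0")
      case True
      then show ?thesis unfolding feq norm_mult norm_power
        by (intro summable_mult summable_geometric) simp
    qed (simp add: f_def gamma_kernel_def)
  qed
  have sint: "summable (\<lambda>k. LINT t|lborel. norm (f k t))"
  proof -
    have eq: "(LINT t|lborel. norm (f k t)) = Gamma (Re s) * (real k + Re v) powr (- Re s)" for k
      using gamma_kernel_integral_norm[of s "of_nat k + v"] s v by (simp add: f_def has_bochner_integral_iff)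
    have "summable (\<lambda>k. (real k + Re v) powr (- Re s))"
    proof (rule summable_comparison_test_ev)
      show "summable (\<lambda>k. real k powr (- Re s))" using s by (simp add: summable_real_powr_iff)
      show "eventually (\<lambda>k. norm ((real k + Re v) powr (- Re s)) \<le> real k powr (- Re s)) sequentially"
        using eventually_gt_at_top[of 0] by eventually_elim (use s v in \<open>auto intro!: powr_mono2'\<close>)
    qed
    then show ?thesis unfolding eq by (rule summable_mult)
  qed
  have fe: "(\<lambda>t. \<Sum>k. f k t) = Z"
    using sums_unique[OF fsums] by (simp add: fun_eq_iff)
  show "integrable lborel Z"
    unfolding fe[symmetric]
    by (rule integrable_suminf) (use int fabs sint in \<open>auto simp: has_bochner_integral_iff\<close>)
  have "(\<lambda>k. integral\<^sup>L lborel (f k)) sums (LINT t|lborel. (\<Sum>k. f k t))"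
    by (rule sums_integral) (use int fabs sint in \<open>auto simp: has_bochner_integral_iff\<close>)
  then show "(\<lambda>k. Gamma s * (of_nat k + v) powr (- s)) sums integral\<^sup>L lborel Z"
    using int unfolding fe by (simp add: has_bochner_integral_iff)
qed

lemma N_poly_Suc_sums:
  assumes z: "norm z < 1" "z \<noteq> 0"
  shows "(\<lambda>n. N_poly (n + 1) m a * z ^ n) sums
    ((((1 + z) powr (a + of_nat m) - (1 + z) powr a) / ln (1 + z) - of_nat m) / z)"
proof -
  have "(\<lambda>n. N_poly (Suc n) m a * z ^ Suc n) sums
      (((1 + z) powr (a + of_nat m) - (1 + z) powr a) / ln (1 + z) - of_nat m)"
    using N_poly_sums[OF z, of m a] by (subst sums_Suc_iff) simp
  from sums_divide[OF this, of z] show ?thesis using z by simp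
qed

text \<open>The generating function is evaluated at \<open>z = q - 1\<close> with
  \<open>q = exp (- t)\<close>. Division by \<open>ln q = - t\<close> lowers \<open>s\<close> to
  \<open>s - 1\<close> in the kernel, and \<open>(1 - q ^ m) / (1 - q)\<close> unfolds into the
  finite sum over \<open>j\<close>.\<close>

lemma N_poly_kernel_sums:
  assumes t: "t > 0"
  shows "(\<lambda>n. (-1) ^ n * N_poly (n + 1) m a * (gamma_kernel s v t * (1 - exp (- of_real t)) ^ n)) sums
    (of_nat m * (gamma_kernel s v t / (1 - exp (- of_real t))) -
     (\<Sum>j=0..<m. gamma_kernel (s - 1) (v + a + of_nat j) t))"
proof -
  define q where "q = exp (- complex_of_real t)"
  define k where "k = gamma_kernel (s - 1) v t"
  have q: "q = of_real (exp (- t))" by (simp add: q_def flip: exp_of_real)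
  have q1: "q \<noteq> 1" using t unfolding q of_real_eq_1_iff by simp
  have "1 - q = of_real (1 - exp (- t))" by (simp add: q)
  then have "norm (1 - q) < 1" using t by (simp only: norm_of_real) simp
  then have z: "norm (q - 1) < 1" "q - 1 \<noteq> 0" using q1 by (auto simp: norm_minus_commute)
  have lnq: "ln q = - of_real t" unfolding q_def by (intro Ln_exp) auto
  have q0: "q \<noteq> 0" by (simp add: q_def)
  have pa: "q powr a = exp (- a * of_real t)" using q0 lnq by (simp add: powr_def)
  have pam: "q powr (a + of_nat m) = q powr a * q ^ m" using q0 by (simp add: powr_add powr_nat')
  have kk: "gamma_kernel s v t = k * of_real t"
    using gamma_kernel_power[of "s - 1" 1 v t] by (simp add: k_def)
  have kj: "gamma_kernel (s - 1) (v + a + of_nat j) t = k * q powr a * q ^ j" for j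
    using gamma_kernel_add[of "s - 1" v a t] gamma_kernel_add[of "s - 1" "v + a" "of_nat j" t]
    unfolding k_def pa unfolding q_def by (simp flip: exp_of_nat_mult)
  have geo: "(\<Sum>j=0..<m. q ^ j) = (1 - q ^ m) / (1 - q)"
    using q1 one_diff_power_eq[of q m] by (simp add: atLeast0LessThan)
  have "(\<lambda>n. gamma_kernel s v t * (N_poly (n + 1) m a * (q - 1) ^ n)) sums
     (gamma_kernel s v t * (((q powr (a + of_nat m) - q powr a) / ln q - of_nat m) / (q - 1)))"
    using N_poly_Suc_sums[OF z, of m a] by (intro sums_mult) simp
  also have "(\<lambda>n. gamma_kernel s v t * (N_poly (n + 1) m a * (q - 1) ^ n)) =
     (\<lambda>n. (-1) ^ n * N_poly (n + 1) m a * (gamma_kernel s v t * (1 - q) ^ n))"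
  proof
    fix n
    have "(q - 1) ^ n = (-1) ^ n * (1 - q) ^ n" by (simp flip: power_mult_distrib)
    then show "gamma_kernel s v t * (N_poly (n + 1) m a * (q - 1) ^ n) =
        (-1) ^ n * N_poly (n + 1) m a * (gamma_kernel s v t * (1 - q) ^ n)" by simp
  qed
  also have "gamma_kernel s v t * (((q powr (a + of_nat m) - q powr a) / ln q - of_nat m) / (q - 1)) =
     of_nat m * (gamma_kernel s v t / (1 - q)) - (\<Sum>j=0..<m. gamma_kernel (s - 1) (v + a + of_nat j) t)"
    unfolding kj sum_distrib_left[symmetric] geo kk pam lnq using t q1
    by (simp add: divide_simps) (simp add: algebra_simps)
  finally show ?thesis by (simp add: q_def)
qed

lemma N_series_hurwitz_pos:
  assumes s: "Re s > 1" and v: "Re v > 0" and a: "Re a \<ge> - 1" and va: "Re v > - Re a"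
  shows "\<exists>Z. (\<lambda>k. (of_nat k + v) powr (- s)) sums Z \<and>
    (\<lambda>n. (-1) ^ n * N_poly (n + 1) m a * power_diff n v s) sums
      (of_nat m * Z - (\<Sum>j=0..<m. (v + a + of_nat j) powr (1 - s)) / (s - 1))"
proof -
  define Z where "Z t = gamma_kernel s v t / (1 - exp (- of_real t))" for t
  define P where "P t = (\<Sum>j=0..<m. gamma_kernel (s - 1) (v + a + of_nat j) t)" for t
  define f where "f n t = (-1) ^ n * N_poly (n + 1) m a * (gamma_kernel s v t * (1 - exp (- of_real t)) ^ n)" for n t
  \<comment> \<open>This functional equation yields the factor \<open>1 / (s - 1)\<close> once
    everything is divided by \<open>Gamma s\<close>.\<close>
  have G: "Gamma s = (s - 1) * Gamma (s - 1)" "Gamma s \<noteq> 0"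
  proof -
    have "s \<noteq> 1" using s by auto
    moreover have "s \<notin> \<int>\<^sub>\<le>\<^sub>0" "s - 1 \<notin> \<int>\<^sub>\<le>\<^sub>0" using s by (auto elim!: nonpos_Ints_cases simp: complex_eq_iff)
    ultimately show "Gamma s = (s - 1) * Gamma (s - 1)" "Gamma s \<noteq> 0"
      using Gamma_plus1[of "s - 1"] by (simp_all add: Gamma_eq_zero_iff)
  qed
  have Z: "integrable lborel Z" "(\<lambda>k. Gamma s * (of_nat k + v) powr (- s)) sums integral\<^sup>L lborel Z"
    using hurwitz_series_integral[OF s v] unfolding Z_def by blast+
  have P: "has_bochner_integral lborel P (\<Sum>j=0..<m. Gamma (s - 1) * (v + a + of_nat j) powr (- (s - 1)))"
    unfolding P_def by (intro has_bochner_integral_sum gamma_kernel_integral) (use s va in auto)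
  have int: "has_bochner_integral lborel (f n) ((-1) ^ n * N_poly (n + 1) m a * (Gamma s * power_diff n v s))" for n
    unfolding f_def using s v by (intro has_bochner_integral_mult_right power_diff_integral) auto
  have fsums: "(\<lambda>n. f n t) sums (of_nat m * Z t - P t)" for t
  proof (cases "t > 0")
    case True
    then show ?thesis unfolding f_def Z_def P_def by (rule N_poly_kernel_sums)
  qed (simp add: f_def Z_def P_def gamma_kernel_def)
  \<comment> \<open>\<open>y > 0\<close> is needed for the decay estimate, \<open>y < Re v\<close>
    for integrability, and \<open>y > - Re a\<close> makes the total exponent
    \<open>Re a + 1 + y\<close> exceed 1.\<close>
  define y where "y = (max 0 (- Re a) + Re v) / 2"
  have y: "0 < y" "y < Re v" "y > - Re a" using v va by (auto simp: y_def)
  obtain C where C: "C \<ge> 0" "\<And>n. norm (N_poly (n + 1) m a) \<le> C * (real n + 1) powr (- (Re a + 1))"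
    using N_poly_bound[OF a, of m] by blast
  define D where "D = exp 1 * y powr y * (Gamma (Re s) * (Re v - y) powr (- Re s))"
  have fabs: "summable (\<lambda>n. norm (f n t))" for t
  proof (cases "t > 0")
    case True
    define u where "u = 1 - exp (- complex_of_real t)"
    have "u = of_real (1 - exp (- t))" by (simp add: u_def flip: exp_of_real)
    then have u: "norm u < 1" using True by (simp only: norm_of_real) simp
    show ?thesis
    proof (rule summable_comparison_test'[where N = 0])
      show "summable (\<lambda>n. C * norm (gamma_kernel s v t) * norm u ^ n)"
        using u by (intro summable_mult summable_geometric) simp
      fix n :: nat
      have "C * (real n + 1) powr (- (Re a + 1)) \<le> C * (real n + 1) powr 0"
        using a C(1) by (intro mult_left_mono powr_mono) auto
      then have "norm (N_poly (n + 1) m a) \<le> C" using C(2)[of n] by simp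
      then have "norm (N_poly (n + 1) m a) * (norm (gamma_kernel s v t) * norm u ^ n) \<le> C * (norm (gamma_kernel s v t) * norm u ^ n)"
        by (intro mult_right_mono) auto
      then show "norm (norm (f n t)) \<le> C * norm (gamma_kernel s v t) * norm u ^ n"
        by (simp add: f_def norm_mult norm_power u_def mult_ac)
    qed
  qed (simp add: f_def gamma_kernel_def)
  have sint: "summable (\<lambda>n. LINT t|lborel. norm (f n t))"
  proof (rule summable_comparison_test'[where N = 0])
    show "summable (\<lambda>n. C * D * (real n + 1) powr (- (Re a + 1 + y)))"
      using y by (intro summable_mult summable_Suc_powr) auto
    fix n :: nat
    have "(LINT t|lborel. norm (f n t)) = norm (N_poly (n + 1) m a) *
       (LINT t|lborel. norm (gamma_kernel s v t * (1 - exp (- of_real t)) ^ n))"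
      unfolding f_def norm_mult[of "_ * N_poly _ _ _"] by (simp add: norm_mult norm_power)
    also have "\<dots> \<le> (C * (real n + 1) powr (- (Re a + 1))) * (D * (real n + 1) powr (- y))"
      unfolding D_def using s y C(1) by (intro mult_mono C(2) power_diff_integral_norm_le) auto
    also have "\<dots> = C * D * (real n + 1) powr (- (Re a + 1 + y))"
      by (simp add: algebra_simps flip: powr_add)
    finally show "norm (LINT t|lborel. norm (f n t)) \<le> C * D * (real n + 1) powr (- (Re a + 1 + y))"
      by simp
  qed
  have fe: "(\<lambda>t. \<Sum>n. f n t) = (\<lambda>t. of_nat m * Z t - P t)"
    using sums_unique[OF fsums] by (simp add: fun_eq_iff)
  have "(\<lambda>n. integral\<^sup>L lborel (f n)) sums (LINT t|lborel. (\<Sum>n. f n t))"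
    by (rule sums_integral) (use int fabs sint in \<open>auto simp: has_bochner_integral_iff\<close>)
  then have "(\<lambda>n. (-1) ^ n * N_poly (n + 1) m a * (Gamma s * power_diff n v s)) sums
     (LINT t|lborel. of_nat m * Z t - P t)"
    using int unfolding fe by (simp add: has_bochner_integral_iff)
  also have "(LINT t|lborel. of_nat m * Z t - P t) = of_nat m * integral\<^sup>L lborel Z -
      (\<Sum>j=0..<m. Gamma (s - 1) * (v + a + of_nat j) powr (- (s - 1)))"
    using Z(1) P by (simp add: has_bochner_integral_iff)
  finally have 1: "(\<lambda>n. (-1) ^ n * N_poly (n + 1) m a * (Gamma s * power_diff n v s)) sums
     (of_nat m * integral\<^sup>L lborel Z - (\<Sum>j=0..<m. Gamma (s - 1) * (v + a + of_nat j) powr (- (s - 1))))" .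
  have s1: "s - 1 \<noteq> 0" "Gamma (s - 1) \<noteq> 0" using G by auto
  have 2: "(of_nat m * integral\<^sup>L lborel Z - (\<Sum>j=0..<m. Gamma (s - 1) * (v + a + of_nat j) powr (- (s - 1)))) / Gamma s =
      of_nat m * (integral\<^sup>L lborel Z / Gamma s) - (\<Sum>j=0..<m. (v + a + of_nat j) powr (1 - s)) / (s - 1)"
    unfolding sum_distrib_left[symmetric] G(1) diff_divide_distrib using s1 by simp
  have "(\<lambda>k. (of_nat k + v) powr (- s)) sums (integral\<^sup>L lborel Z / Gamma s)"
    using sums_divide[OF Z(2), of "Gamma s"] G(2) by simp
  moreover have "(\<lambda>n. (-1) ^ n * N_poly (n + 1) m a * power_diff n v s) sums
      (of_nat m * (integral\<^sup>L lborel Z / Gamma s) - (\<Sum>j=0..<m. (v + a + of_nat j) powr (1 - s)) / (s - 1))"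
    using sums_divide[OF 1, of "Gamma s"] G(2) unfolding 2 by (simp add: mult.assoc)
  ultimately show ?thesis by blast
qed

text \<open>Pascal's rule for the coefficients is matched with \<open>power_diff_Suc\<close>. The
  term with \<open>v powr (- s)\<close> stems from \<open>N_poly 0 m (a - 1) = m\<close>; the last
  term is the boundary term.\<close>

lemma N_series_summation_by_parts:
  "(\<Sum>n<Suc M. (-1) ^ n * N_poly (n + 1) m a * power_diff n v s) =
    of_nat m * v powr (- s) + (\<Sum>n<M. (-1) ^ n * N_poly (n + 1) m (a - 1) * power_diff n (v + 1) s) +
    (-1) ^ M * N_poly (M + 1) m (a - 1) * power_diff M v s"
proof (induction M)
  case 0
  then show ?case using N_poly_Suc[of 0 m a] by (simp add: algebra_simps)
next
  case (Suc M)
  have "power_diff M v s = power_diff (Suc M) v s + power_diff M (v + 1) s"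
    by (simp add: power_diff_Suc)
  with Suc show ?case
    using N_poly_Suc[of "Suc M" m a] by (simp add: algebra_simps)
qed

lemma N_series_hurwitz:
  assumes s: "Re s > 1" and a: "Re a \<ge> - 1" and va: "Re v > - Re a"
  shows "\<exists>Z. (\<lambda>k. (of_nat k + v) powr (- s)) sums Z \<and>
    (\<lambda>n. (-1) ^ n * N_poly (n + 1) m a * power_diff n v s) sums
      (of_nat m * Z - (\<Sum>j=0..<m. (v + a + of_nat j) powr (1 - s)) / (s - 1))"
proof -
  obtain N :: nat where "real N > - Re v" using reals_Archimedean2 by blast
  then have "Re v > - real N" by linarith
  then show ?thesis using a va
  proof (induction N arbitrary: v a)
    case 0
    then show ?case using N_series_hurwitz_pos[OF s] by simp
  next
    case (Suc N)
    show ?case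
    proof (cases "Re v > 0")
      case True
      then show ?thesis using N_series_hurwitz_pos[OF s] Suc.prems by blast
    next
      case False
      let ?S = "\<Sum>j=0..<m. (v + a + of_nat j) powr (1 - s)"
      let ?b = "\<lambda>n. (-1) ^ n * N_poly (n + 1) m (a - 1)"
      \<comment> \<open>From \<open>Re v \<le> 0\<close> and \<open>Re v > - Re a\<close> it follows
        that \<open>Re a > 0\<close>, so the shifted parameter stays admissible;
        \<open>v + a\<close> is unchanged.\<close>
      have a1: "Re (a - 1) \<ge> - 1" using False Suc.prems by simp
      have "v + 1 + (a - 1) = v + a" by simp
      then obtain Z where Z: "(\<lambda>k. (of_nat k + (v + 1)) powr (- s)) sums Z"
        "(\<lambda>n. ?b n * power_diff n (v + 1) s) sums (of_nat m * Z - ?S / (s - 1))"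
        using Suc.IH[of "v + 1" "a - 1"] Suc.prems a1 by auto
      have "(\<lambda>k. (of_nat (Suc k) + v) powr (- s)) sums Z"
        using Z(1) by (simp add: algebra_simps)
      then have zs: "(\<lambda>k. (of_nat k + v) powr (- s)) sums (Z + v powr (- s))"
        by (subst (asm) sums_Suc_iff) simp
      \<comment> \<open>The boundary term is \<open>O((M + 1) powr (- (y + Re a)))\<close> with
        \<open>y\<close> midway between \<open>- Re a\<close> and \<open>Re v\<close>, so the
        exponent is negative.\<close>
      have lim0: "(\<lambda>M. ?b M * power_diff M v s) \<longlonglongrightarrow> 0"
      proof -
        define y where "y = (Re v - Re a) / 2"
        have y: "y < Re v" "y + Re a > 0" using Suc.prems by (auto simp: y_def field_simps)
        obtain C where C: "C \<ge> 0" "\<And>n. norm (N_poly (n + 1) m (a - 1)) \<le> C * (real n + 1) powr (- (Re (a - 1) + 1))"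
          using N_poly_bound[OF a1, of m] by blast
        obtain D where D: "D \<ge> 0" "\<And>z n. z \<in> {s} \<Longrightarrow> norm (power_diff n v z) \<le> D * (real n + 1) powr (- y)"
          using power_diff_bound[OF compact_sing[of s] y(1)] by blast
        show ?thesis
        proof (rule tendsto_0_le[where K = 1])
          have "(\<lambda>M. (real M + 1) powr (- (y + Re a))) \<longlonglongrightarrow> 0"
            using y filterlim_tendsto_add_at_top[OF tendsto_const filterlim_real_sequentially, of 1]
            by (intro tendsto_neg_powr) (auto simp: add.commute)
          from tendsto_mult_right_zero[OF this, of "C * D"]
          show "(\<lambda>M. C * D * (real M + 1) powr (- (y + Re a))) \<longlonglongrightarrow> 0" .
          show "eventually (\<lambda>M. norm (?b M * power_diff M v s) \<le> norm (C * D * (real M + 1) powr (- (y + Re a))) * 1) sequentially"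
          proof (intro always_eventually allI)
            fix M
            have "norm (?b M * power_diff M v s) = norm (N_poly (M + 1) m (a - 1)) * norm (power_diff M v s)"
              by (simp add: norm_mult norm_power)
            also have "\<dots> \<le> (C * (real M + 1) powr (- (Re (a - 1) + 1))) * (D * (real M + 1) powr (- y))"
              using C(1) by (intro mult_mono C(2) D(2)) auto
            also have "\<dots> = C * D * (real M + 1) powr (- (y + Re a))"
              by (simp add: algebra_simps flip: powr_add)
            finally show "norm (?b M * power_diff M v s) \<le> norm (C * D * (real M + 1) powr (- (y + Re a))) * 1"
              using C(1) D(1) by simp
          qed
        qed
      qed
      have "(\<lambda>M. of_nat m * v powr (- s) + (\<Sum>n<M. ?b n * power_diff n (v + 1) s) + ?b M * power_diff M v s)
         \<longlonglongrightarrow> of_nat m * v powr (- s) + (of_nat m * Z - ?S / (s - 1)) + 0"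
        using Z(2) unfolding sums_def by (intro tendsto_intros lim0)
      then have "(\<lambda>M. \<Sum>n<Suc M. (-1) ^ n * N_poly (n + 1) m a * power_diff n v s)
         \<longlonglongrightarrow> of_nat m * (Z + v powr (- s)) - ?S / (s - 1)"
        unfolding N_series_summation_by_parts by (simp add: algebra_simps)
      then have "(\<lambda>n. (-1) ^ n * N_poly (n + 1) m a * power_diff n v s) sums (of_nat m * (Z + v powr (- s)) - ?S / (s - 1))"
        unfolding sums_def by (rule LIMSEQ_imp_Suc)
      with zs show ?thesis by blast
    qed
  qed
qed

section \<open>Holomorphy of the series in \<open>s\<close> and analytic continuation\<close>

lemma power_diff_holomorphic [holomorphic_intros]: "(\<lambda>s. power_diff n v s) holomorphic_on A"
proof -
  have "(\<lambda>s. w powr (- s)) holomorphic_on A" for w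
    by (cases "w = 0") (auto intro!: holomorphic_intros simp: powr_def)
  then show ?thesis unfolding power_diff_def by (intro holomorphic_intros)
qed

text \<open>The decay rates of coefficients and differences add up to an exponent above 1, giving a
  summable majorant independent of \<open>s\<close> in \<open>K\<close>, as the Weierstrass test
  requires.\<close>

lemma N_series_bound:
  assumes "compact K" and a: "Re a \<ge> - 1" and va: "Re v > - Re a"
  shows "\<exists>M. summable M \<and> (\<forall>s\<in>K. \<forall>n. norm ((-1) ^ n * N_poly (n + 1) m a * power_diff n v s) \<le> M n)"
proof -
  define y where "y = (Re v - Re a) / 2"
  have y: "y < Re v" "y + Re a > 0" using va by (auto simp: y_def field_simps)
  obtain C where C: "C \<ge> 0" "\<And>n. norm (N_poly (n + 1) m a) \<le> C * (real n + 1) powr (- (Re a + 1))"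
    using N_poly_bound[OF a, of m] by blast
  obtain D where D: "D \<ge> 0" "\<And>s n. s \<in> K \<Longrightarrow> norm (power_diff n v s) \<le> D * (real n + 1) powr (- y)"
    using power_diff_bound[OF assms(1) y(1)] by blast
  have "norm ((-1) ^ n * N_poly (n + 1) m a * power_diff n v s) \<le> C * D * (real n + 1) powr (- (Re a + 1 + y))"
    if "s \<in> K" for s n
  proof -
    have "norm ((-1) ^ n * N_poly (n + 1) m a * power_diff n v s) = norm (N_poly (n + 1) m a) * norm (power_diff n v s)"
      by (simp add: norm_mult norm_power)
    also have "\<dots> \<le> (C * (real n + 1) powr (- (Re a + 1))) * (D * (real n + 1) powr (- y))"
      using C(1) that by (intro mult_mono C(2) D(2)) auto
    also have "\<dots> = C * D * (real n + 1) powr (- (Re a + 1 + y))"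
      by (simp add: algebra_simps flip: powr_add)
    finally show ?thesis .
  qed
  moreover have "summable (\<lambda>n. C * D * (real n + 1) powr (- (Re a + 1 + y)))"
    using y by (intro summable_mult summable_Suc_powr) auto
  ultimately show ?thesis by blast
qed

lemma N_series_summable:
  assumes "Re a \<ge> - 1" "Re v > - Re a"
  shows "summable (\<lambda>n. (-1) ^ n * N_poly (n + 1) m a * power_diff n v s)"
proof -
  obtain M where M: "summable M" "\<forall>z\<in>{s}. \<forall>n. norm ((-1) ^ n * N_poly (n + 1) m a * power_diff n v z) \<le> M n"
    using N_series_bound[OF compact_sing[of s] assms, of m] by (elim exE conjE) (rule that)
  show ?thesis by (rule summable_comparison_test'[OF M(1)]) (use M(2) in blast)
qed

lemma N_series_holomorphic:
  assumes "Re a \<ge> - 1" "Re v > - Re a"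
  shows "(\<lambda>s. \<Sum>n. (-1) ^ n * N_poly (n + 1) m a * power_diff n v s) holomorphic_on UNIV"
proof (rule holomorphic_uniform_sequence[where f = "\<lambda>k s. \<Sum>n<k. (-1) ^ n * N_poly (n + 1) m a * power_diff n v s"])
  fix s :: complex
  obtain M where M: "summable M" "\<forall>z\<in>cball s 1. \<forall>n. norm ((-1) ^ n * N_poly (n + 1) m a * power_diff n v z) \<le> M n"
    using N_series_bound[OF compact_cball[of s 1] assms, of m] by (elim exE conjE) (rule that)
  have "uniform_limit (cball s 1) (\<lambda>k s. \<Sum>n<k. (-1) ^ n * N_poly (n + 1) m a * power_diff n v s)
     (\<lambda>s. \<Sum>n. (-1) ^ n * N_poly (n + 1) m a * power_diff n v s) sequentially"
    by (rule Weierstrass_m_test[OF _ M(1)]) (use M(2) in blast)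
  then show "\<exists>d>0. cball s d \<subseteq> UNIV \<and> uniform_limit (cball s d) (\<lambda>k s. \<Sum>n<k. (-1) ^ n * N_poly (n + 1) m a * power_diff n v s)
     (\<lambda>s. \<Sum>n. (-1) ^ n * N_poly (n + 1) m a * power_diff n v s) sequentially"
    by (intro exI[of _ 1]) auto
qed (auto intro!: holomorphic_intros)

text \<open>Two continuations agree on the open half-plane \<open>Re z > 1\<close>, hence on the
  connected punctured plane. This resolves the definite description.\<close>

lemma hurwitz_zeta_eqI:
  assumes f: "f holomorphic_on - {1}" "\<And>z. Re z > 1 \<Longrightarrow> (\<lambda>n. (of_nat n + v) powr (- z)) sums f z"
    and s: "s \<noteq> 1"
  shows "hurwitz_zeta s v = f s"
  unfolding hurwitz_zeta_def
proof (rule the_equality)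
  fix w
  assume "\<exists>g. g holomorphic_on - {1} \<and> (\<forall>z. Re z > 1 \<longrightarrow> (\<lambda>n. (of_nat n + v) powr (- z)) sums g z) \<and> w = g s"
  then obtain g where g: "g holomorphic_on - {1}" "\<And>z. Re z > 1 \<Longrightarrow> (\<lambda>n. (of_nat n + v) powr (- z)) sums g z" "w = g s"
    by blast
  have "g s = f s"
  proof (rule analytic_continuation_open[where s = "{z. Re z > 1}" and s' = "- {1}" and f = g and g = f])
    show "open {z. Re z > 1}" by (rule open_halfspace_Re_gt)
    show "{z::complex. Re z > 1} \<noteq> {}" by (auto intro!: exI[of _ 2])
    show "connected (- {1::complex})" by (rule connected_punctured_universe) simp
    show "g z = f z" if "z \<in> {z. Re z > 1}" for z
      using that f(2) g(2) sums_unique2 by blast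
  qed (use f(1) g(1) s in auto)
  with g(3) show "w = f s" by simp
qed (use f in blast)

lemma hurwitz_zeta_N_series:
  assumes s: "s \<noteq> 1" and m: "m > 0" and a: "Re a \<ge> - 1" and va: "Re v > - Re a"
  shows "hurwitz_zeta s v = 1 / (of_nat m * (s - 1)) * (\<Sum>n=0..m - 1. (v + a + of_nat n) powr (1 - s)) +
     1 / of_nat m * (\<Sum>n. (-1) ^ n * N_poly (n + 1) m a * power_diff n v s)"
proof (rule hurwitz_zeta_eqI[OF _ _ s])
  have "v + a + of_nat n \<noteq> 0" for n
  proof -
    have "Re (v + a + of_nat n) > 0" using va by simp
    then show ?thesis by force
  qed
  then show "(\<lambda>s. 1 / (of_nat m * (s - 1)) * (\<Sum>n=0..m - 1. (v + a + of_nat n) powr (1 - s)) +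
     1 / of_nat m * (\<Sum>n. (-1) ^ n * N_poly (n + 1) m a * power_diff n v s)) holomorphic_on - {1}"
    using m by (intro holomorphic_intros holomorphic_on_subset[OF N_series_holomorphic[OF a va]]) auto
next
  fix z :: complex assume z: "Re z > 1"
  have z1: "z - 1 \<noteq> 0" using z by auto
  obtain Z where Z: "(\<lambda>k. (of_nat k + v) powr (- z)) sums Z"
    "(\<lambda>n. (-1) ^ n * N_poly (n + 1) m a * power_diff n v z) sums
      (of_nat m * Z - (\<Sum>j=0..<m. (v + a + of_nat j) powr (1 - z)) / (z - 1))"
    using N_series_hurwitz[OF z a va] by blast
  have m0: "complex_of_nat m \<noteq> 0" using m by simp
  \<comment> \<open>Positivity of \<open>m\<close> matters: with truncated subtraction the left side
    would be \<open>{0}\<close> for \<open>m = 0\<close>.\<close>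
  have m1: "{0..m - 1} = {0..<m}" using m by auto
  have "w = 1 / (k * d) * r + 1 / k * (k * w - r / d)" if "k \<noteq> 0" "d \<noteq> 0" for k d r w :: complex
    using that by (simp add: right_diff_distrib)
  from this[of "of_nat m" "z - 1" Z "\<Sum>n=0..<m. (v + a + of_nat n) powr (1 - z)"]
  have "Z = 1 / (of_nat m * (z - 1)) * (\<Sum>n=0..m - 1. (v + a + of_nat n) powr (1 - z)) +
     1 / of_nat m * (\<Sum>n. (-1) ^ n * N_poly (n + 1) m a * power_diff n v z)"
    unfolding sums_unique[OF Z(2), symmetric] m1 using m0 z1 by blast
  with Z(1) show "(\<lambda>n. (of_nat n + v) powr (- z)) sums (1 / (of_nat m * (z - 1)) * (\<Sum>n=0..m - 1. (v + a + of_nat n) powr (1 - z)) +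
     1 / of_nat m * (\<Sum>n. (-1) ^ n * N_poly (n + 1) m a * power_diff n v z))"
    by simp
qed

theorem theorem3:
  fixes s :: complex
  assumes "s \<noteq> 1"
  shows
    "(\<forall>v. Re v > 0 \<longrightarrow>
        summable (\<lambda>n. of_real \<bar>gregory_coeff (n + 1)\<bar> *
          (\<Sum>k=0..n. (-1) ^ k * of_nat (n choose k) * (of_nat k + v) powr (- s))) \<and>
        hurwitz_zeta s v = v powr (1 - s) / (s - 1) +
          (\<Sum>n. of_real \<bar>gregory_coeff (n + 1)\<bar> *
            (\<Sum>k=0..n. (-1) ^ k * of_nat (n choose k) * (of_nat k + v) powr (- s)))) \<and>
     (\<forall>v. Re v > 1 \<longrightarrow>
        summable (\<lambda>n. of_real (cauchy_coeff (n + 1)) *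
          (\<Sum>k=0..n. (-1) ^ k * of_nat (n choose k) * (of_nat k + v) powr (- s))) \<and>
        hurwitz_zeta s v = (v - 1) powr (1 - s) / (s - 1) -
          (\<Sum>n. of_real (cauchy_coeff (n + 1)) *
            (\<Sum>k=0..n. (-1) ^ k * of_nat (n choose k) * (of_nat k + v) powr (- s)))) \<and>
     (\<forall>m::nat. m > 0 \<longrightarrow>
        (\<forall>a v. Re a \<ge> -1 \<longrightarrow> Re v > - Re a \<longrightarrow>
          summable (\<lambda>n. (-1) ^ n * N_poly (n + 1) m a *
            (\<Sum>k=0..n. (-1) ^ k * of_nat (n choose k) * (of_nat k + v) powr (- s))) \<and>
          hurwitz_zeta s v =
            1 / (of_nat m * (s - 1)) * (\<Sum>n=0..m - 1. (v + a + of_nat n) powr (1 - s)) +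
            1 / of_nat m * (\<Sum>n. (-1) ^ n * N_poly (n + 1) m a *
              (\<Sum>k=0..n. (-1) ^ k * of_nat (n choose k) * (of_nat k + v) powr (- s)))) \<and>
        (\<forall>n. \<exists>p. \<forall>a. N_poly n m a = poly p a) \<and>
        (\<forall>n a. N_poly n m a = bernoulli2_poly (n + 1) (a + of_nat m) - bernoulli2_poly (n + 1) a) \<and>
        (\<forall>a. generating_function (\<lambda>n. N_poly n m a)
           (\<lambda>z. ((1 + z) powr (a + of_nat m) - (1 + z) powr a) / ln (1 + z))))"
  unfolding power_diff_def[symmetric]
proof (intro conjI allI impI)
  fix v :: complex assume v: "Re v > 0"
  show "summable (\<lambda>n. of_real \<bar>gregory_coeff (n + 1)\<bar> * power_diff n v s)"
    using N_series_summable[of 0 v 1 s] v unfolding N_poly_1_0 by simp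
  show "hurwitz_zeta s v = v powr (1 - s) / (s - 1) + (\<Sum>n. of_real \<bar>gregory_coeff (n + 1)\<bar> * power_diff n v s)"
    using hurwitz_zeta_N_series[OF assms, of 1 0 v] v unfolding N_poly_1_0 by simp
next
  fix v :: complex assume v: "Re v > 1"
  \<comment> \<open>At \<open>a = -1\<close> the condition \<open>Re v > - Re a\<close> reads
    \<open>Re v > 1\<close>, and the coefficients are the negated Cauchy numbers, so the negated
    series comes first.\<close>
  have sm: "summable (\<lambda>n. - (of_real (cauchy_coeff (n + 1)) * power_diff n v s))"
    using N_series_summable[of "-1" v 1 s] v unfolding N_poly_1_minus_1 by simp
  then show sm': "summable (\<lambda>n. of_real (cauchy_coeff (n + 1)) * power_diff n v s)"
    by (simp only: summable_minus_iff)
  have "hurwitz_zeta s v = (v - 1) powr (1 - s) / (s - 1) + (\<Sum>n. - (of_real (cauchy_coeff (n + 1)) * power_diff n v s))"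
    using hurwitz_zeta_N_series[OF assms, of 1 "-1" v] v unfolding N_poly_1_minus_1 by simp
  also have "(\<Sum>n. - (of_real (cauchy_coeff (n + 1)) * power_diff n v s)) = - (\<Sum>n. of_real (cauchy_coeff (n + 1)) * power_diff n v s)"
    by (rule suminf_minus[OF sm'])
  finally show "hurwitz_zeta s v = (v - 1) powr (1 - s) / (s - 1) - (\<Sum>n. of_real (cauchy_coeff (n + 1)) * power_diff n v s)"
    by simp
qed (intro N_series_summable hurwitz_zeta_N_series assms N_poly_is_poly N_poly_eq_bernoulli2_poly_diff
      generating_function_N_poly; assumption)+

end
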